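(* Let $k\geq 1$ be an integer. There exist two positive constants $\alpha_k$ and $\gamma_k$, depending only on $k$, such that the following holds. Let $\lambda\in(0,1)$, let $I$ be a subarc of $\mathbb T$ of length $2\pi\lambda$, and let $f\in H^{k,2}$ with $\|f\|_{k,2}\leq 1$ satisfy $\|f\|_{2,I}\leq e^{-\gamma_k/\lambda}$. Then $$\|f\|_2\leq \frac{\alpha_k}{\left(\lambda\log(1/\|f\|_{2,I})\right)^k}.$$
   Context: $\mathbb D$ is the open unit disk and $\mathbb T$ the unit circle. $H^2$ is the Hardy space of analytic functions in $\mathbb D$ with bounded $L^2$ means on circles of radius $r\to1$, with $\|f\|_2=\left(\frac{1}{2\pi}\int_0^{2\pi}|f(e^{i\theta})|^2d\theta\right)^{1/2}$ computed on boundary values. For an integer $k\ge1$, the Hardy–Sobolev space is $H^{k,2}=\{f\in H^2: f^{(j)}\in H^2,\ j=1,\dots,k\}$ with norm $\|f\|_{k,2}^2=\sum_{j=0}^k\|f^{(j)}\|_2^2$ (derivatives with respect to the complex variable $z$). For a subarc $I\subset\mathbb T$ of length $2\pi\lambda$, $\|f\|_{2,I}=\left(\frac{1}{2\pi\lambda}\int_I|f(e^{i\theta})|^2d\theta\right)^{1/2}$. *)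

theory Defs
  imports "HOL-Analysis.Analysis"
begin

definition H2 :: "(complex \<Rightarrow> complex) set" where
  "H2 = {f. f holomorphic_on ball 0 1 \<and>
     (\<exists>M. \<forall>r. 0 \<le> r \<and> r < 1 \<longrightarrow>
        (LINT \<theta>:{0..2*pi}|lborel. (cmod (f (complex_of_real r * cis \<theta>)))\<^sup>2) / (2*pi) \<le> M)}"

text \<open>Boundary values: radial limits (they exist for a.e. angle when f is in H^2).\<close>
definition boundary_val :: "(complex \<Rightarrow> complex) \<Rightarrow> real \<Rightarrow> complex" where
  "boundary_val f \<theta> = Lim (at_left 1) (\<lambda>r. f (complex_of_real r * cis \<theta>))"

definition H2_norm :: "(complex \<Rightarrow> complex) \<Rightarrow> real" where
  "H2_norm f = sqrt ((LINT \<theta>:{0..2*pi}|lborel. (cmod (boundary_val f \<theta>))\<^sup>2) / (2*pi))"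

definition arc_norm :: "(complex \<Rightarrow> complex) \<Rightarrow> real \<Rightarrow> real \<Rightarrow> real" where
  "arc_norm f a lam = sqrt ((LINT \<theta>:{a..a + 2*pi*lam}|lborel. (cmod (boundary_val f \<theta>))\<^sup>2) / (2*pi*lam))"

definition HS :: "nat \<Rightarrow> (complex \<Rightarrow> complex) set" where
  "HS k = {f. f \<in> H2 \<and> (\<forall>j\<in>{1..k}. (deriv ^^ j) f \<in> H2)}"

definition HS_norm :: "nat \<Rightarrow> (complex \<Rightarrow> complex) \<Rightarrow> real" where
  "HS_norm k f = sqrt (\<Sum>j=0..k. (H2_norm ((deriv ^^ j) f))\<^sup>2)"

end

theory Submission
  imports Defs "HOL-Complex_Analysis.Complex_Analysis"
begin

text \<open>Let \<open>m\<close> be the norm of \<open>f\<close> and \<open>\<epsilon>\<close> its norm on the arc. Multiply \<open>f\<close> by the outer function \<open>h\<close> whose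
  modulus is \<open>s = m / \<epsilon>\<close> on the arc and 1 on the rest of the circle: \<open>f h\<close> has norm at most \<open>sqrt 2 m\<close>,
  while on the circle of radius \<open>exp (- \<delta>)\<close> Harnack's inequality gives \<open>\<bar>h\<bar> \<ge> s powr (c \<lambda> \<delta>)\<close>. So the
  frequencies of \<open>f\<close> below \<open>1/\<delta>\<close> carry at most \<open>C m\<^sup>2 s powr (- 2 c \<lambda> \<delta>)\<close>, and those above carry at most
  \<open>(k \<delta>) ^ (2 k)\<close> because of the Sobolev norm. With \<open>\<delta>\<close> a large multiple of \<open>1 / (\<lambda> log (1/\<epsilon>))\<close>, either
  \<open>m\<close> is of order \<open>\<delta> ^ k\<close> or \<open>m \<le> sqrt \<epsilon>\<close>.

  The norms are integrals of radial limits, so the Sobolev bound on Taylor coefficients needs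
  Fatou's theorem for \<open>H\<^sup>2\<close>, to exclude that the \<open>k\<close>-th derivative has a junk boundary function.\<close>

section \<open>Fourier series on an arc of length two pi\<close>

text \<open>The function \<open>f\<close> itself causes no trouble at the boundary:
  \<open>deriv f\<close> in \<open>H2\<close> makes its Taylor coefficients absolutely summable, so
  its radial limits form a continuous function and the comparison with the outer function uses only
  a constant majorant. The k-th derivative has just square summable coefficients, and
  \<open>boundary_val\<close> takes an arbitrary value wherever a radial limit fails to exist. Its
  primitive is the remedy: dividing the n-th coefficient by \<open>n\<close> restores absolute
  summability, the primitive is differentiable almost everywhere by Lebesgue's theorem, and the Abel
  means of its differentiated series, which are the values on a radius up to the constant term,
  converge at such points. Constants: with \<delta> = 16 / (\<open>lam\<close> * L) and L = log
  (1/\<epsilon>), the critical case has s \<ge> exp (L/2), which with the kernel bound \<delta>/4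
  yields a gain of exp 4 against a loss of 4 * exp 2. The threshold \<gamma> = 16 k says exactly
  that \<delta> k \<le> 1, so that every frequency above 1/\<delta> exceeds k and is seen by the
  k-th derivative.\<close>

definition seg :: "real \<Rightarrow> real measure" where
  "seg a = restrict_space lborel {a..a + 2*pi}"

lemma finite_measure_seg: "finite_measure (seg a)"
  unfolding seg_def by (rule finite_measureI) (simp add: emeasure_restrict_space space_restrict_space)

lemma integrable_seg_const [simp]: "integrable (seg a) (\<lambda>_. c :: 'a::{banach, second_countable_topology})"
  by (rule finite_measure.integrable_const[OF finite_measure_seg])

lemma seg_measurable: "f \<in> borel_measurable borel \<Longrightarrow> f \<in> borel_measurable (seg a)"
  unfolding seg_def by (rule measurable_restrict_space1) simp

text \<open>The base point of the circle is left free because each use wants another one: an arc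
  starting at \<open>a\<close> is an initial piece of \<open>seg a\<close>, \<open>seg 0\<close>
  matches the definition of the norms, and \<open>seg (-pi)\<close> centres the Poisson
  kernel.\<close>

lemma set_integral_seg:
  fixes f :: "real \<Rightarrow> 'a::{banach, second_countable_topology}"
  shows "(LINT x:{a..a+2*pi}|lborel. f x) = integral\<^sup>L (seg a) f"
  unfolding seg_def by (subst integral_restrict_space) (auto simp: set_lebesgue_integral_def)

lemma AE_segI: "AE x in lborel. a \<le> x \<longrightarrow> x \<le> a + 2*pi \<longrightarrow> P x \<Longrightarrow> AE x in seg a. P x"
  unfolding seg_def by (subst AE_restrict_space_iff) auto

lemma measure_seg: "measure (seg a) (space (seg a)) = 2*pi"
  unfolding seg_def by (simp add: measure_restrict_space space_restrict_space)

lemma integrable_seg_bounded: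
  fixes f :: "real \<Rightarrow> 'a::{banach, second_countable_topology}"
  assumes "f \<in> borel_measurable (seg a)" "\<And>x. norm (f x) \<le> B"
  shows "integrable (seg a) f"
  using finite_measure.integrable_const_bound[OF finite_measure_seg _ assms(1)] assms(2) by auto

lemma integrable_seg_continuous:
  fixes f :: "real \<Rightarrow> 'a::{banach, second_countable_topology}"
  assumes "continuous_on UNIV f"
  shows "integrable (seg a) f"
proof -
  have "set_integrable lborel {a..a+2*pi} f"
    by (rule borel_integrable_atLeastAtMost') (use assms continuous_on_subset in blast)
  then show ?thesis unfolding seg_def by (simp add: integrable_restrict_space set_integrable_def)
qed

lemma integral_seg_FTC:
  fixes f :: "real \<Rightarrow> 'a::euclidean_space"
  assumes "\<And>x. (F has_vector_derivative f x) (at x)" "continuous_on UNIV f"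
  shows "integral\<^sup>L (seg a) f = F (a + 2*pi) - F a"
proof -
  have "has_bochner_integral lborel (\<lambda>x. indicator {a..a+2*pi} x *\<^sub>R f x) (F (a+2*pi) - F a)"
    by (rule has_bochner_integral_FTC_Icc)
       (auto intro: assms has_vector_derivative_at_within continuous_on_subset[OF assms(2)])
  then show ?thesis
    unfolding set_integral_seg[symmetric] set_lebesgue_integral_def by (rule has_bochner_integral_integral_eq)
qed

lemma has_vector_derivative_cis:
  "((\<lambda>t. cis (c * t)) has_vector_derivative \<i> * c * cis (c * t)) (at t within S)"
proof -
  have "((\<lambda>z. exp (\<i> * c * z)) has_field_derivative \<i> * c * exp (\<i> * c * of_real t)) (at (of_real t))"
    by (auto intro!: derivative_eq_intros)
  from has_vector_derivative_real_field[OF this, of S] show ?thesis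
    by (simp add: cis_conv_exp mult.assoc)
qed

text \<open>Frequencies are integers because products with conjugates produce negative ones; for a
  nonzero frequency the antiderivative is periodic.\<close>

lemma integral_seg_cis:
  "integral\<^sup>L (seg a) (\<lambda>t. cis (of_int n * t)) = (if n = 0 then 2*pi else 0)"
proof (cases "n = 0")
  case True
  then show ?thesis by (simp add: measure_seg scaleR_conv_of_real)
next
  case False
  have "((\<lambda>t. cis (of_int n * t) / (\<i> * of_int n)) has_vector_derivative cis (of_int n * t)) (at t)" for t
    using has_vector_derivative_divide[OF has_vector_derivative_cis[of "of_int n" t UNIV], of "\<i> * of_int n"] False by simp
  then have "integral\<^sup>L (seg a) (\<lambda>t. cis (of_int n * t)) =
      cis (of_int n * (a + 2*pi)) / (\<i> * of_int n) - cis (of_int n * a) / (\<i> * of_int n)"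
    by (rule integral_seg_FTC) (auto intro!: continuous_intros)
  also have "cis (of_int n * (a + 2*pi)) = cis (of_int n * a)"
    using cis_multiple_2pi[of "of_int n"] by (simp add: ring_distribs cis_mult[symmetric] mult_ac)
  finally show ?thesis using False by simp
qed

text \<open>Absolute summability supplies the majorant for exchanging sum and integral. The free
  weight \<open>\<phi>\<close> covers coefficient extraction, Parseval and the moments of the
  Poisson kernels.\<close>

lemma integral_seg_series:
  fixes c :: "nat \<Rightarrow> complex"
  assumes c: "summable (\<lambda>n. norm (c n))" and \<phi>: "integrable (seg a) \<phi>"
  shows "integrable (seg a) (\<lambda>t. (\<Sum>n. c n * cis (n * t)) * \<phi> t)"
    and "(\<lambda>n. c n * integral\<^sup>L (seg a) (\<lambda>t. cis (n * t) * \<phi> t)) sums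
           integral\<^sup>L (seg a) (\<lambda>t. (\<Sum>n. c n * cis (n * t)) * \<phi> t)"
proof -
  have int: "integrable (seg a) (\<lambda>t. c n * cis (n * t) * \<phi> t)" for n
  proof (rule Bochner_Integration.integrable_bound)
    show "integrable (seg a) (\<lambda>t. cmod (c n) * norm (\<phi> t))" using \<phi> by simp
    have "(\<lambda>t. cis (n * t)) \<in> borel_measurable (seg a)"
      by (rule seg_measurable, rule borel_measurable_continuous_onI) (auto intro!: continuous_intros)
    then show "(\<lambda>t. c n * cis (n * t) * \<phi> t) \<in> borel_measurable (seg a)"
      using \<phi> by measurable
  qed (auto simp: norm_mult)
  have s: "summable (\<lambda>n. c n * cis (n * t))" for t :: real
    by (rule summable_norm_cancel) (use c in \<open>simp add: norm_mult\<close>)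
  have eq: "(\<Sum>n. c n * cis (n * t)) * \<phi> t = (\<Sum>n. c n * cis (n * t) * \<phi> t)" for t :: real
    using suminf_mult2[OF s] by simp
  have 1: "AE t in seg a. summable (\<lambda>n. norm (c n * cis (n * t) * \<phi> t))"
    using c by (auto simp: norm_mult intro!: summable_mult2)
  have 2: "summable (\<lambda>n. integral\<^sup>L (seg a) (\<lambda>t. norm (c n * cis (n * t) * \<phi> t)))"
    using c by (auto simp: norm_mult intro!: summable_mult2)
  show "integrable (seg a) (\<lambda>t. (\<Sum>n. c n * cis (n * t)) * \<phi> t)"
    using integrable_suminf[OF int 1 2] by (simp add: eq)
  show "(\<lambda>n. c n * integral\<^sup>L (seg a) (\<lambda>t. cis (n * t) * \<phi> t)) sums
           integral\<^sup>L (seg a) (\<lambda>t. (\<Sum>n. c n * cis (n * t)) * \<phi> t)"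
    using sums_integral[OF int 1 2] unfolding eq by (simp add: mult.assoc)
qed

lemma integral_seg_coeff:
  fixes c :: "nat \<Rightarrow> complex"
  assumes c: "summable (\<lambda>n. norm (c n))"
  shows "integral\<^sup>L (seg a) (\<lambda>t. (\<Sum>n. c n * cis (n * t)) * cis (- (m * t))) = 2 * pi * c m"
proof -
  have "integrable (seg a) (\<lambda>t. cis (- (real m * t)))"
    by (rule integrable_seg_continuous) (auto intro!: continuous_intros)
  from integral_seg_series(2)[OF c this]
  have "(\<lambda>n. c n * integral\<^sup>L (seg a) (\<lambda>t. cis (of_int (int n - int m) * t))) sums
      integral\<^sup>L (seg a) (\<lambda>t. (\<Sum>n. c n * cis (n * t)) * cis (- (m * t)))"
    by (simp add: cis_mult left_diff_distrib)
  then have "(\<lambda>n. if n = m then 2 * pi * c m else 0) sums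
      integral\<^sup>L (seg a) (\<lambda>t. (\<Sum>n. c n * cis (n * t)) * cis (- (m * t)))"
    unfolding integral_seg_cis by (rule sums_cong[THEN iffD1, rotated]) auto
  then show ?thesis using sums_single[of m "\<lambda>_. 2 * pi * c m"] sums_unique2 by blast
qed

lemma integral_seg_coeff_cnj:
  fixes d :: "nat \<Rightarrow> complex"
  assumes d: "summable (\<lambda>n. norm (d n))"
  shows "integral\<^sup>L (seg a) (\<lambda>t. cis (n * t) * cnj (\<Sum>n. d n * cis (n * t))) = 2 * pi * cnj (d n)"
    and "integrable (seg a) (\<lambda>t. cnj (\<Sum>n. d n * cis (n * t)))"
proof -
  have "integrable (seg a) (\<lambda>t. (\<Sum>n. d n * cis (n * t)) * 1)"
    by (rule integral_seg_series(1)[OF d]) simp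
  then show "integrable (seg a) (\<lambda>t. cnj (\<Sum>n. d n * cis (n * t)))" by simp
  have "integral\<^sup>L (seg a) (\<lambda>t. cis (n * t) * cnj (\<Sum>n. d n * cis (n * t))) =
     integral\<^sup>L (seg a) (\<lambda>t. cnj ((\<Sum>n. d n * cis (n * t)) * cis (- (n * t))))"
    by (intro Bochner_Integration.integral_cong) (auto simp: cis_cnj)
  also have "\<dots> = cnj (2 * pi * d n)"
    unfolding Bochner_Integration.integral_cnj integral_seg_coeff[OF d] ..
  finally show "integral\<^sup>L (seg a) (\<lambda>t. cis (n * t) * cnj (\<Sum>n. d n * cis (n * t))) = 2 * pi * cnj (d n)"
    by simp
qed

lemma integral_seg_parseval:
  fixes c d :: "nat \<Rightarrow> complex"
  assumes c: "summable (\<lambda>n. norm (c n))" and d: "summable (\<lambda>n. norm (d n))"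
  shows "(\<lambda>n. 2 * pi * (c n * cnj (d n))) sums
     integral\<^sup>L (seg a) (\<lambda>t. (\<Sum>n. c n * cis (n * t)) * cnj (\<Sum>n. d n * cis (n * t)))"
  using integral_seg_series(2)[OF c integral_seg_coeff_cnj(2)[OF d], of a]
  unfolding integral_seg_coeff_cnj(1)[OF d] by (simp add: mult_ac)

lemma integral_seg_parseval_norm:
  fixes c :: "nat \<Rightarrow> complex"
  assumes c: "summable (\<lambda>n. norm (c n))"
  shows "(\<lambda>n. 2 * pi * (cmod (c n))\<^sup>2) sums
     integral\<^sup>L (seg a) (\<lambda>t. (cmod (\<Sum>n. c n * cis (n * t)))\<^sup>2)"
proof -
  have "(\<lambda>n. complex_of_real (2 * pi * (cmod (c n))\<^sup>2)) sums
     integral\<^sup>L (seg a) (\<lambda>t. complex_of_real ((cmod (\<Sum>n. c n * cis (n * t)))\<^sup>2))"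
    using integral_seg_parseval[OF c c, of a]
    by (simp only: complex_norm_square of_real_mult of_real_numeral)
  then show ?thesis unfolding integral_complex_of_real sums_of_real_iff .
qed

section \<open>Circle means and the Poisson kernel\<close>

definition taylor_coeff :: "(complex \<Rightarrow> complex) \<Rightarrow> nat \<Rightarrow> complex" where
  "taylor_coeff g n = (deriv ^^ n) g 0 / fact n"

lemma taylor_series_circle:
  fixes t :: real
  assumes g: "g holomorphic_on ball 0 1" and r: "0 \<le> r" "r < 1"
  shows "summable (\<lambda>n. norm (taylor_coeff g n * of_real r ^ n))"
    and "g (of_real r * cis t) = (\<Sum>n. taylor_coeff g n * of_real r ^ n * cis (n * t))"
proof -
  have s: "(\<lambda>n. taylor_coeff g n * w ^ n) sums g w" if "norm w < 1" for w
    using holomorphic_power_series[OF g, of w] that by (simp add: taylor_coeff_def)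
  show "summable (\<lambda>n. norm (taylor_coeff g n * of_real r ^ n))"
    \<comment> \<open>The series also converges at (r + 1)/2 < 1, a point further out than
      \<open>r\<close>, hence absolutely at \<open>r\<close>.\<close>
    by (rule powser_insidea[OF sums_summable[OF s[of "of_real ((r + 1) / 2)"]]])
       (use r in \<open>auto simp del: of_real_divide of_real_add\<close>)
  have "norm (of_real r * cis t) < 1" using r by (simp add: norm_mult)
  from s[OF this] show "g (of_real r * cis t) = (\<Sum>n. taylor_coeff g n * of_real r ^ n * cis (n * t))"
    by (simp add: sums_iff power_mult_distrib Complex.DeMoivre mult.assoc)
qed

lemma circle_mean_square:
  assumes g: "g holomorphic_on ball 0 1" and r: "0 \<le> r" "r < 1"
  shows "(\<lambda>n. 2 * pi * ((cmod (taylor_coeff g n))\<^sup>2 * r ^ (2 * n))) sums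
    integral\<^sup>L (seg a) (\<lambda>t. (cmod (g (of_real r * cis t)))\<^sup>2)"
  using integral_seg_parseval_norm[OF taylor_series_circle(1)[OF assms], of a] r
  unfolding taylor_series_circle(2)[OF assms]
  by (simp add: norm_mult norm_power power_mult_distrib power_mult[symmetric] mult.commute[of 2])

text \<open>Each term of the coefficient formula increases with the radius, so subharmonicity is not
  called upon.\<close>

lemma circle_mean_square_mono:
  assumes g: "g holomorphic_on ball 0 1" and r: "0 \<le> r" "r \<le> s" "s < 1"
  shows "integral\<^sup>L (seg a) (\<lambda>t. (cmod (g (of_real r * cis t)))\<^sup>2)
       \<le> integral\<^sup>L (seg a) (\<lambda>t. (cmod (g (of_real s * cis t)))\<^sup>2)"
  by (rule sums_le[OF _ circle_mean_square[OF g] circle_mean_square[OF g]])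
     (use r in \<open>auto intro!: mult_left_mono power_mono\<close>)

lemma H2_coeff_square_summable:
  assumes "g \<in> H2"
  shows "summable (\<lambda>n. (cmod (taylor_coeff g n))\<^sup>2)"
proof -
  from assms obtain M where g: "g holomorphic_on ball 0 1" and M: "\<And>r. 0 \<le> r \<Longrightarrow> r < 1 \<Longrightarrow>
     integral\<^sup>L (seg 0) (\<lambda>t. (cmod (g (of_real r * cis t)))\<^sup>2) / (2*pi) \<le> M"
    unfolding H2_def set_integral_seg[of 0, simplified, symmetric] by auto
  \<comment> \<open>Finite sections come first: for them the limit r -> 1 is continuity of a
    polynomial, and a uniform bound on all sections gives summability.\<close>
  have "(\<Sum>n<N. (cmod (taylor_coeff g n))\<^sup>2) \<le> M" for N
  proof (rule tendsto_upperbound[where F = "at_left 1"])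
    show "((\<lambda>r. \<Sum>n<N. (cmod (taylor_coeff g n))\<^sup>2 * r ^ (2 * n)) \<longlongrightarrow> (\<Sum>n<N. (cmod (taylor_coeff g n))\<^sup>2)) (at_left (1::real))"
      by (auto intro!: tendsto_eq_intros)
    have "(\<Sum>n<N. (cmod (taylor_coeff g n))\<^sup>2 * r ^ (2 * n)) \<le> M" if r: "0 < r" "r < 1" for r
    proof -
      have "(\<Sum>n<N. 2 * pi * ((cmod (taylor_coeff g n))\<^sup>2 * r ^ (2 * n))) \<le>
        integral\<^sup>L (seg 0) (\<lambda>t. (cmod (g (of_real r * cis t)))\<^sup>2)"
        using circle_mean_square[OF g, of r 0] r unfolding sums_iff
        by (metis (no_types, lifting) sum_le_suminf finite_lessThan mult_nonneg_nonneg pi_ge_zero zero_le_numeral zero_le_power2 zero_le_even_power' less_imp_le power_even_eq zero_le_power)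
      also have "\<dots> \<le> 2 * pi * M" using M[of r] r by (simp add: field_simps)
      finally show ?thesis unfolding sum_distrib_left[symmetric] by simp
    qed
    then show "\<forall>\<^sub>F r in at_left 1. (\<Sum>n<N. (cmod (taylor_coeff g n))\<^sup>2 * r ^ (2 * n)) \<le> M"
      using eventually_at_left_real[of 0 "1::real"] by (auto elim!: eventually_mono)
  qed auto
  then show ?thesis
    by (intro bounded_imp_summable[where B = M]) (simp, metis lessThan_Suc_atMost)
qed

section \<open>The Poisson kernel, its angular derivative and their moments\<close>

definition poisson_den :: "real \<Rightarrow> real \<Rightarrow> real" where
  "poisson_den r t = 1 - 2 * r * cos t + r\<^sup>2"

definition poisson_kernel :: "real \<Rightarrow> real \<Rightarrow> real" where
  "poisson_kernel r t = (1 - r\<^sup>2) / poisson_den r t"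

text \<open>The negative of the angular derivative of \<open>poisson_kernel\<close>. The sign is the
  one left by integration by parts, so that integrating a boundary function against it reproduces
  the derivative of that function.\<close>

definition poisson_deriv :: "real \<Rightarrow> real \<Rightarrow> real" where
  "poisson_deriv r t = 2 * r * (1 - r\<^sup>2) * sin t / (poisson_den r t)\<^sup>2"

lemma poisson_den_eq_norm: "poisson_den r t = (cmod (1 - of_real r * cis t))\<^sup>2"
  unfolding cmod_power2 poisson_den_def
  by (simp add: power_mult_distrib sin_squared_eq) algebra

text \<open>A sum of two nonnegative terms: the first gives positivity, the second the size of the
  denominator away from t = 0.\<close>

lemma poisson_den_eq_sin: "poisson_den r t = (1 - r)\<^sup>2 + 4 * r * (sin (t/2))\<^sup>2"
proof -
  have "cos t = 1 - 2 * (sin (t/2))\<^sup>2" using cos_double_sin[of "t/2"] by simp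
  then show ?thesis unfolding poisson_den_def by algebra
qed

lemma poisson_den_pos: "0 \<le> r \<Longrightarrow> r < 1 \<Longrightarrow> poisson_den r t > 0"
  unfolding poisson_den_eq_sin by (intro add_pos_nonneg) auto

lemma poisson_kernel_pos: "0 \<le> r \<Longrightarrow> r < 1 \<Longrightarrow> poisson_kernel r t > 0"
  unfolding poisson_kernel_def by (intro divide_pos_pos poisson_den_pos) (auto simp: power_less_one_iff abs_square_less_1)

lemma continuous_poisson:
  assumes "0 \<le> r" "r < 1"
  shows "continuous_on UNIV (poisson_kernel r)" "continuous_on UNIV (poisson_deriv r)"
proof -
  have "poisson_den r t \<noteq> 0" for t using poisson_den_pos[OF assms, of t] by simp
  moreover have "continuous_on UNIV (poisson_den r)"
    unfolding poisson_den_def by (intro continuous_intros)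
  ultimately show "continuous_on UNIV (poisson_kernel r)" "continuous_on UNIV (poisson_deriv r)"
    unfolding poisson_kernel_def poisson_deriv_def by (auto intro!: continuous_intros)
qed

text \<open>The kernel is (1 - r^2) times the squared modulus of a geometric series
  \<open>D\<close>, so its n-th moment is a Parseval sum of \<open>d m * d (m + n)\<close>, again
  geometric.\<close>

lemma integral_poisson_kernel_cis:
  assumes r: "0 \<le> r" "r < 1"
  shows "integral\<^sup>L (seg a) (\<lambda>t. cis (n * t) * of_real (poisson_kernel r t)) = 2 * pi * of_real r ^ n"
proof -
  define d where "d = (\<lambda>m. complex_of_real r ^ m)"
  have d: "summable (\<lambda>m. norm (d m))" using r by (simp add: d_def norm_power summable_geometric)
  define D where "D = (\<lambda>t::real. \<Sum>m. d m * cis (m * t))"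
  have D: "D t = 1 / (1 - of_real r * cis t)" for t
  proof -
    have "(\<lambda>m. (of_real r * cis t) ^ m) sums (1 / (1 - of_real r * cis t))"
      by (rule geometric_sums) (use r in \<open>simp add: norm_mult\<close>)
    then show ?thesis by (simp add: D_def d_def sums_iff power_mult_distrib Complex.DeMoivre)
  qed
  have kernel: "of_real (poisson_kernel r t) = of_real (1 - r\<^sup>2) * (D t * cnj (D t))" for t
    unfolding poisson_kernel_def poisson_den_eq_norm D complex_norm_square[symmetric]
    by (simp add: norm_divide power_divide)
  have int_D: "integrable (seg a) (\<lambda>t. cnj (D t))"
    unfolding D_def by (rule integral_seg_coeff_cnj(2)[OF d])
  have int: "integrable (seg a) (\<lambda>t. cnj (D t) * cis (n * t))"
  proof (rule Bochner_Integration.integrable_bound[OF int_D])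
    have "(\<lambda>t. cis (n * t)) \<in> borel_measurable (seg a)"
      by (rule seg_measurable, rule borel_measurable_continuous_onI) (auto intro!: continuous_intros)
    then show "(\<lambda>t. cnj (D t) * cis (n * t)) \<in> borel_measurable (seg a)"
      by (intro borel_measurable_times borel_measurable_integrable[OF int_D])
  qed (simp add: norm_mult)
  have D_fold: "(\<Sum>m. d m * cis (m * t)) = D t" for t :: real by (simp add: D_def)
  from integral_seg_series(2)[OF d int]
  have "(\<lambda>m. d m * integral\<^sup>L (seg a) (\<lambda>t. cis (real (m + n) * t) * cnj (D t))) sums
      integral\<^sup>L (seg a) (\<lambda>t. D t * (cnj (D t) * cis (n * t)))"
    unfolding D_fold by (simp add: cis_mult[symmetric] ring_distribs mult_ac)
  then have "(\<lambda>m. d m * (2 * pi * d (m + n))) sums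
      integral\<^sup>L (seg a) (\<lambda>t. D t * (cnj (D t) * cis (n * t)))"
    unfolding D_def integral_seg_coeff_cnj(1)[OF d] by (simp add: d_def)
  moreover have "(\<lambda>m. d m * (2 * pi * d (m + n))) sums (2 * pi * d n * (1 / (1 - (of_real r)\<^sup>2)))"
  proof -
    have "(\<lambda>m. 2 * pi * d n * ((of_real r)\<^sup>2) ^ m) sums (2 * pi * d n * (1 / (1 - (of_real r)\<^sup>2)))"
      by (intro sums_mult geometric_sums) (use r in \<open>simp add: norm_power power_less_one_iff abs_square_less_1\<close>)
    then show ?thesis by (simp add: d_def power_add power2_eq_square power_mult_distrib mult_ac)
  qed
  ultimately have I: "integral\<^sup>L (seg a) (\<lambda>t. D t * (cnj (D t) * cis (n * t))) = 2 * pi * d n * (1 / (1 - (of_real r)\<^sup>2))"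
    by (rule sums_unique2)
  have "(1 - (complex_of_real r)\<^sup>2) \<noteq> 0"
    using r by (metis abs_square_less_1 abs_of_nonneg eq_iff_diff_eq_0 less_irrefl of_real_1 of_real_eq_iff of_real_power)
  moreover have "integral\<^sup>L (seg a) (\<lambda>t. cis (n * t) * of_real (poisson_kernel r t)) =
      integral\<^sup>L (seg a) (\<lambda>t. of_real (1 - r\<^sup>2) * (D t * (cnj (D t) * cis (n * t))))"
    by (simp only: kernel mult_ac)
  ultimately show ?thesis using I by (simp add: d_def)
qed

text \<open>The rotation by \<open>\<theta>\<close> is absorbed into the ratio of the geometric
  series, which avoids a periodic change of variables.\<close>

lemma integral_poisson_kernel:
  assumes r: "0 \<le> r" "r < 1"
  shows "integral\<^sup>L (seg a) (\<lambda>t. poisson_kernel r (t - \<theta>)) = 2 * pi"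
proof -
  define c where "c = (\<lambda>n. (of_real r * cis (- \<theta>)) ^ n)"
  have c: "summable (\<lambda>n. norm (c n))" using r by (simp add: c_def norm_power norm_mult summable_geometric)
  have "(\<lambda>n. c n * cis (n * t)) sums (1 / (1 - of_real r * cis (t - \<theta>)))" for t :: real
  proof -
    have "(\<lambda>n. (of_real r * cis (t - \<theta>)) ^ n) sums (1 / (1 - of_real r * cis (t - \<theta>)))"
      by (rule geometric_sums) (use r in \<open>simp add: norm_mult\<close>)
    moreover have "(of_real r * cis (t - \<theta>)) ^ n = c n * cis (n * t)" for n
      by (simp add: c_def power_mult_distrib Complex.DeMoivre cis_mult right_diff_distrib)
    ultimately show ?thesis by simp
  qed
  then have kernel: "poisson_kernel r (t - \<theta>) = (1 - r\<^sup>2) * (cmod (\<Sum>n. c n * cis (n * t)))\<^sup>2" for t :: real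
    by (simp add: sums_iff poisson_kernel_def poisson_den_eq_norm norm_divide power_divide)
  have r2: "norm (r\<^sup>2) < 1" using r by (simp add: power_less_one_iff abs_square_less_1)
  have "(\<lambda>n. 2 * pi * (cmod (c n))\<^sup>2) sums (2 * pi * (1 / (1 - r\<^sup>2)))"
  proof -
    have "(cmod (c n))\<^sup>2 = (r\<^sup>2) ^ n" for n
      using r by (simp add: c_def norm_power norm_mult power_mult[symmetric] mult.commute)
    then show ?thesis using sums_mult[OF geometric_sums[OF r2], of "2 * pi"] by simp
  qed
  with integral_seg_parseval_norm[OF c, of a]
  have "integral\<^sup>L (seg a) (\<lambda>t. (cmod (\<Sum>n. c n * cis (n * t)))\<^sup>2) = 2 * pi * (1 / (1 - r\<^sup>2))"
    by (rule sums_unique2)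
  then show ?thesis using r2 by (simp add: kernel)
qed

lemma poisson_kernel_has_derivative:
  assumes r: "0 \<le> r" "r < 1"
  shows "(poisson_kernel r has_real_derivative - poisson_deriv r t) (at t)"
proof -
  have "poisson_den r t \<noteq> 0" using poisson_den_pos[OF assms, of t] by simp
  moreover have "(poisson_den r has_real_derivative 2 * r * sin t) (at t)"
    unfolding poisson_den_def by (auto intro!: derivative_eq_intros)
  ultimately show ?thesis
    unfolding poisson_kernel_def poisson_deriv_def
    by (auto intro!: derivative_eq_intros simp: power2_eq_square field_simps)
qed

text \<open>Integration by parts against the moments of \<open>poisson_kernel\<close>; the boundary
  terms cancel by periodicity.\<close>

lemma integral_poisson_deriv_cis:
  assumes r: "0 \<le> r" "r < 1"
  shows "integral\<^sup>L (seg a) (\<lambda>t. cis (n * t) * of_real (poisson_deriv r t)) = 2 * pi * (\<i> * n * of_real r ^ n)"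
proof -
  let ?P = "\<lambda>t::real. cis (n * t) * complex_of_real (poisson_kernel r t)"
  let ?Q = "\<lambda>t::real. cis (n * t) * complex_of_real (poisson_deriv r t)"
  have cP: "continuous_on UNIV ?P" and cQ: "continuous_on UNIV ?Q"
    using continuous_poisson[OF r] by (auto intro!: continuous_intros)
  have "(?P has_vector_derivative \<i> * n * ?P t - ?Q t) (at t)" for t
  proof -
    have "((\<lambda>t. complex_of_real (poisson_kernel r t)) has_vector_derivative of_real (- poisson_deriv r t)) (at t)"
      using poisson_kernel_has_derivative[OF r, of t]
      by (intro has_vector_derivative_of_real) (simp add: has_real_derivative_iff_has_vector_derivative)
    from has_vector_derivative_mult[OF has_vector_derivative_cis[of "real n" t UNIV] this]
    show ?thesis by (simp add: algebra_simps)
  qed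
  then have "integral\<^sup>L (seg a) (\<lambda>t. \<i> * n * ?P t - ?Q t) = ?P (a + 2*pi) - ?P a"
    by (rule integral_seg_FTC) (use cP cQ in \<open>auto intro!: continuous_intros\<close>)
  also have "\<dots> = 0"
  proof -
    have "cis (n * (a + 2*pi)) = cis (n * a)"
      using cis_multiple_2pi[of "of_nat n"] by (simp add: ring_distribs cis_mult[symmetric] mult_ac)
    then show ?thesis by (simp add: poisson_kernel_def poisson_den_def)
  qed
  finally have "\<i> * n * integral\<^sup>L (seg a) ?P - integral\<^sup>L (seg a) ?Q = 0"
    using integrable_seg_continuous[OF cP, of a] integrable_seg_continuous[OF cQ, of a]
    by (simp add: Bochner_Integration.integral_diff)
  then have "integral\<^sup>L (seg a) ?Q = \<i> * n * integral\<^sup>L (seg a) ?P" by simp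
  also have "\<dots> = 2 * pi * (\<i> * n * of_real r ^ n)"
    unfolding integral_poisson_kernel_cis[OF r] by simp
  finally show ?thesis .
qed

section \<open>Radial limits at points of differentiability\<close>

text \<open>By the half-angle formula the numerator gains a second factor sin (t/2), and 4 r sin
  (t/2)^2 is part of \<open>poisson_den r t\<close>, so one power of the denominator
  cancels.\<close>

lemma poisson_deriv_sin_le:
  assumes r: "0 \<le> r" "r < 1"
  shows "\<bar>sin (t/2)\<bar> * \<bar>poisson_deriv r t\<bar> \<le> poisson_kernel r t"
proof -
  have p: "poisson_den r t > 0" by (rule poisson_den_pos[OF r])
  have "\<bar>sin (t/2)\<bar> * (2 * r * \<bar>sin t\<bar>) = 4 * r * (sin (t/2))\<^sup>2 * \<bar>cos (t/2)\<bar>"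
    using sin_double[of "t/2"] r by (simp add: abs_mult power2_eq_square)
  also have "\<dots> \<le> 4 * r * (sin (t/2))\<^sup>2" using r by (intro mult_right_le_one_le) auto
  also have "\<dots> \<le> poisson_den r t" unfolding poisson_den_eq_sin by simp
  finally have "\<bar>sin (t/2)\<bar> * (2 * r * \<bar>sin t\<bar>) * (1 - r\<^sup>2) \<le> poisson_den r t * (1 - r\<^sup>2)"
    by (rule mult_right_mono) (use r in \<open>simp add: abs_square_le_1\<close>)
  moreover have "\<bar>poisson_deriv r t\<bar> = 2 * r * \<bar>sin t\<bar> * (1 - r\<^sup>2) / (poisson_den r t)\<^sup>2"
    using r by (simp add: poisson_deriv_def abs_mult abs_square_le_1)
  ultimately have "\<bar>sin (t/2)\<bar> * \<bar>poisson_deriv r t\<bar> \<le> poisson_den r t * (1 - r\<^sup>2) / (poisson_den r t)\<^sup>2"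
    by (simp add: divide_right_mono mult.assoc)
  also have "\<dots> = poisson_kernel r t" using p by (simp add: poisson_kernel_def power2_eq_square)
  finally show ?thesis .
qed

text \<open>Away from t = 0 the denominator stays above 1 - C, because r \<ge> 1/2 makes 2 r at
  least 1; the differentiated kernel therefore tends to 0 uniformly there as r -> 1.\<close>

lemma poisson_deriv_away_le:
  assumes r: "1/2 \<le> r" "r < 1" and t: "cos t \<le> C" "C < 1"
  shows "\<bar>poisson_deriv r t\<bar> \<le> 2 * (1 - r\<^sup>2) / (1 - C)\<^sup>2"
proof -
  have r1: "r\<^sup>2 \<le> 1" using r by (simp add: abs_square_le_1)
  have "1 - C \<le> 2 * r * (1 - C)" using r t by simp
  also have "\<dots> \<le> 2 * r * (1 - cos t)" using r t by (intro mult_left_mono) auto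
  also have "\<dots> \<le> 2 * r * (1 - cos t) + (1 - r)\<^sup>2" by simp
  also have "\<dots> = poisson_den r t" unfolding poisson_den_def by algebra
  finally have "(1 - C)\<^sup>2 \<le> (poisson_den r t)\<^sup>2" using t by (intro power_mono) auto
  moreover have "2 * r * (1 - r\<^sup>2) * \<bar>sin t\<bar> \<le> 2 * (1 - r\<^sup>2)"
  proof -
    have "r * \<bar>sin t\<bar> \<le> 1 * 1" using r by (intro mult_mono) auto
    from mult_right_mono[OF this, of "2 * (1 - r\<^sup>2)"] r1 show ?thesis by (simp add: mult_ac)
  qed
  moreover have "\<bar>poisson_deriv r t\<bar> = 2 * r * (1 - r\<^sup>2) * \<bar>sin t\<bar> / (poisson_den r t)\<^sup>2"
    using r r1 by (simp add: poisson_deriv_def abs_mult)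
  ultimately show ?thesis using t r1 by (auto intro!: frac_le)
qed

lemma abs_le_abs_sin_half: "\<forall>\<^sub>F t in at 0. \<bar>t::real\<bar> \<le> 4 * \<bar>sin (t/2)\<bar>"
proof -
  have "((\<lambda>t::real. sin (t/2)) has_real_derivative 1/2) (at 0)"
    by (auto intro!: derivative_eq_intros)
  then have "((\<lambda>t::real. sin (t/2) / t) \<longlongrightarrow> 1/2) (at 0)"
    by (simp add: has_field_derivative_iff)
  then have "\<forall>\<^sub>F t::real in at 0. 1/4 < sin (t/2) / t" by (rule order_tendstoD) simp
  moreover have "\<forall>\<^sub>F t::real in at 0. t \<noteq> 0" by (simp add: eventually_at_filter)
  ultimately show ?thesis
  proof eventually_elim
    case (elim t)
    have "\<bar>1/4 * t\<bar> \<le> \<bar>sin (t/2) / t * t\<bar>" unfolding abs_mult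
      by (intro mult_right_mono) (use elim(1) in linarith)+
    then show ?case using elim by simp
  qed
qed

lemma continuous_on_cis_series:
  fixes c :: "nat \<Rightarrow> complex"
  assumes c: "summable (\<lambda>n. norm (c n))"
  shows "continuous_on UNIV (\<lambda>t::real. \<Sum>n. c n * cis (n * t))"
proof (rule uniform_limit_theorem[OF _ Weierstrass_m_test])
  show "\<forall>\<^sub>F N in sequentially. continuous_on UNIV (\<lambda>t::real. \<Sum>n<N. c n * cis (n * t))"
    by (intro always_eventually allI continuous_intros)
  show "norm (c n * cis (n * t)) \<le> norm (c n)" for n and t :: real by (simp add: norm_mult)
qed (use c in auto)

lemma norm_cis_series_le:
  fixes c :: "nat \<Rightarrow> complex" and t :: real
  assumes c: "summable (\<lambda>n. norm (c n))"
  shows "norm (\<Sum>n. c n * cis (n * t)) \<le> (\<Sum>n. norm (c n))"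
  using summable_norm[of "\<lambda>n. c n * cis (n * t)"] c by (simp add: norm_mult)

lemma integral_cis_series_poisson_deriv:
  fixes c :: "nat \<Rightarrow> complex" and x :: real
  assumes c: "summable (\<lambda>n. norm (c n))" and r: "0 \<le> r" "r < 1"
  shows "(\<lambda>n. 2 * pi * (\<i> * n * c n * of_real r ^ n * cis (n * x))) sums
    integral\<^sup>L (seg a) (\<lambda>t. (\<Sum>n. c n * cis (n * (x + t))) * of_real (poisson_deriv r t))"
proof -
  have int: "integrable (seg a) (\<lambda>t. complex_of_real (poisson_deriv r t))"
    by (intro integrable_seg_continuous continuous_intros continuous_poisson r)
  have c': "summable (\<lambda>n. norm (c n * cis (n * x)))" using c by (simp add: norm_mult)
  from integral_seg_series(2)[OF c' int] show ?thesis
    unfolding integral_poisson_deriv_cis[OF r] by (simp add: ring_distribs cis_mult[symmetric] mult_ac)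
qed

text \<open>Fatou's theorem for the derivative of a continuous boundary function.  Subtracting
  \<open>D sin t\<close>, which the kernel reproduces exactly, leaves a boundary function that is \<open>o(sin (t/2))\<close>
  at \<open>x\<close>, and \<open>sin (t/2)\<close> times the differentiated Poisson kernel is dominated by the kernel itself.\<close>

lemma abel_sum_at_differentiability_point:
  fixes c :: "nat \<Rightarrow> complex" and x :: real
  assumes c: "summable (\<lambda>n. norm (c n))"
    and D: "((\<lambda>t::real. \<Sum>n. c n * cis (n * t)) has_vector_derivative D) (at x)"
  shows "((\<lambda>r. \<Sum>n. \<i> * n * c n * of_real r ^ n * cis (n * x)) \<longlongrightarrow> D) (at_left 1)"
proof -
  define \<Phi> where "\<Phi> = (\<lambda>t::real. \<Sum>n. c n * cis (n * t))"
  define \<Psi> where "\<Psi> = (\<lambda>t::real. \<Phi> (x + t) - \<Phi> x - D * of_real (sin t))"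
  define S where "S = (\<lambda>r::real. \<Sum>n. \<i> * n * c n * of_real r ^ n * cis (n * x))"
  define M where "M = 2 * (\<Sum>n. norm (c n)) + norm D"
  have M0: "M \<ge> 0" unfolding M_def using suminf_nonneg[OF c] by auto
  have \<Psi>_le: "norm (\<Psi> t) \<le> M" for t
  proof -
    have "norm (\<Psi> t) \<le> norm (\<Phi> (x + t)) + norm (\<Phi> x) + norm (D * of_real (sin t))"
      unfolding \<Psi>_def by norm
    also have "norm (D * of_real (sin t)) \<le> norm D" by (simp add: norm_mult mult_left_le)
    finally show ?thesis
      using norm_cis_series_le[OF c, of "x + t"] norm_cis_series_le[OF c, of x]
      unfolding M_def \<Phi>_def by simp
  qed
  have cont_\<Phi>: "continuous_on UNIV \<Phi>" unfolding \<Phi>_def by (rule continuous_on_cis_series[OF c])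
  have cont_\<Psi>: "continuous_on UNIV \<Psi>" unfolding \<Psi>_def
    by (intro continuous_intros continuous_on_compose2[OF cont_\<Phi>]) auto

  have \<Psi>_small: "\<exists>d>0. \<forall>t. \<bar>t\<bar> < d \<longrightarrow> norm (\<Psi> t) \<le> e * \<bar>sin (t/2)\<bar>" if e: "e > 0" for e
  proof -
    have "((+) x has_vector_derivative 1) (at 0)" by (auto intro!: derivative_eq_intros)
    then have "((\<lambda>t. \<Phi> (x + t)) has_vector_derivative D) (at 0)"
      using D[folded \<Phi>_def] vector_diff_chain_at[of "\<lambda>t. x + t" 1 0 \<Phi> D]
      by (simp add: o_def)
    moreover have "((\<lambda>t. D * complex_of_real (sin t)) has_vector_derivative D) (at 0)"
      using has_vector_derivative_mult_right[OF has_vector_derivative_of_real, of sin 1 "at 0" D]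
        DERIV_sin[of 0, unfolded has_real_derivative_iff_has_vector_derivative] by simp
    ultimately have "(\<Psi> has_vector_derivative 0) (at 0)"
      unfolding \<Psi>_def by (auto intro!: derivative_eq_intros)
    moreover have "\<Psi> 0 = 0" by (simp add: \<Psi>_def)
    ultimately have "\<forall>e>0. \<forall>\<^sub>F t in at 0. norm (\<Psi> t) \<le> e * \<bar>t\<bar>"
      unfolding has_vector_derivative_def has_derivative_within_alt2 by simp
    then have "\<forall>\<^sub>F t in at 0. norm (\<Psi> t) \<le> e / 4 * \<bar>t\<bar>"
      using e by (metis divide_pos_pos zero_less_numeral)
    with abs_le_abs_sin_half have "\<forall>\<^sub>F t in at 0. norm (\<Psi> t) \<le> e * \<bar>sin (t/2)\<bar>"
    proof eventually_elim
      case (elim t)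
      have "e * \<bar>t\<bar> \<le> 4 * (e * \<bar>sin (t/2)\<bar>)" using mult_left_mono[OF elim(1), of e] e by (simp add: mult_ac)
      moreover have "4 * norm (\<Psi> t) \<le> e * \<bar>t\<bar>" using elim(2) by simp
      ultimately show ?case by linarith
    qed
    then obtain d where "d > 0" "\<And>t. t \<noteq> 0 \<Longrightarrow> \<bar>t\<bar> < d \<Longrightarrow> norm (\<Psi> t) \<le> e * \<bar>sin (t/2)\<bar>"
      unfolding eventually_at by (auto simp: dist_real_def)
    then show ?thesis using \<open>\<Psi> 0 = 0\<close> by (metis mult_zero_right norm_zero sin_zero abs_zero div_0 order_refl)
  qed

  \<comment> \<open>The constant \<open>\<Phi> x\<close> has zero integral against the kernel
    (moment 0), and \<open>sin\<close> has integral 2 pi r, the imaginary part of moment 1. Hence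
    \<open>D\<close> appears here multiplied by \<open>r\<close>; the factor disappears in the
    limit.\<close>
  have rep: "2 * pi * (S r - of_real r * D) =
      integral\<^sup>L (seg (-pi)) (\<lambda>t. \<Psi> t * of_real (poisson_deriv r t))" if r: "0 \<le> r" "r < 1" for r
  proof -
    let ?Q = "\<lambda>t. complex_of_real (poisson_deriv r t)"
    have contQ: "continuous_on UNIV ?Q" by (intro continuous_intros continuous_poisson r)
    have "(\<lambda>n. 2 * pi * (\<i> * n * c n * of_real r ^ n * cis (n * x))) sums
        integral\<^sup>L (seg (-pi)) (\<lambda>t. \<Phi> (x + t) * ?Q t)"
      unfolding \<Phi>_def by (rule integral_cis_series_poisson_deriv[OF c r])
    from sums_mult[OF this, of "1 / (2 * pi)"]
    have I1: "integral\<^sup>L (seg (-pi)) (\<lambda>t. \<Phi> (x + t) * ?Q t) = 2 * pi * S r"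
      unfolding S_def by (simp add: sums_iff mult.assoc)
    have I0: "integral\<^sup>L (seg (-pi)) ?Q = 0"
      using integral_poisson_deriv_cis[OF r, of "-pi" 0] by simp
    have "integral\<^sup>L (seg (-pi)) (\<lambda>t. Im (cis t * ?Q t)) = Im (2 * pi * (\<i> * r))"
      using integral_poisson_deriv_cis[OF r, of "-pi" 1] contQ
      by (subst integral_Im) (auto intro!: integrable_seg_continuous continuous_intros)
    then have I2: "integral\<^sup>L (seg (-pi)) (\<lambda>t. of_real (sin t) * ?Q t) = 2 * pi * of_real r"
      by (simp flip: of_real_mult)
    have eq: "\<Psi> t * ?Q t = \<Phi> (x + t) * ?Q t - \<Phi> x * ?Q t - D * (of_real (sin t) * ?Q t)" for t
      unfolding \<Psi>_def by (simp add: algebra_simps)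
    have iA: "integrable (seg (-pi)) (\<lambda>t. \<Phi> (x + t) * ?Q t)"
      and iB: "integrable (seg (-pi)) (\<lambda>t. \<Phi> x * ?Q t)"
      and iC: "integrable (seg (-pi)) (\<lambda>t. D * (of_real (sin t) * ?Q t))"
      by (intro integrable_seg_continuous continuous_intros contQ continuous_on_compose2[OF cont_\<Phi>]; simp)+
    have "integral\<^sup>L (seg (-pi)) (\<lambda>t. \<Psi> t * ?Q t) = 2 * pi * S r - \<Phi> x * 0 - D * (2 * pi * of_real r)"
      unfolding eq I1[symmetric] I2[symmetric] I0[symmetric]
        Bochner_Integration.integral_diff[OF Bochner_Integration.integrable_diff[OF iA iB] iC]
        Bochner_Integration.integral_diff[OF iA iB] by simp
    then show ?thesis by (simp add: algebra_simps)
  qed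

  have "((\<lambda>r. S r - of_real r * D) \<longlongrightarrow> 0) (at_left 1)"
  proof (rule tendstoI)
    fix e :: real assume e: "e > 0"
    from \<Psi>_small[of "e/2"] e obtain d' where d': "d' > 0" and sm': "\<And>t. \<bar>t\<bar> < d' \<Longrightarrow> norm (\<Psi> t) \<le> e/2 * \<bar>sin (t/2)\<bar>"
      by auto
    \<comment> \<open>The cap at pi keeps [d, pi] inside the range where cos decreases, so that |t|
      \<ge> d yields cos t \<le> cos d < 1.\<close>
    define d where "d = min d' pi"
    have d: "0 < d" "d \<le> pi" using d' pi_gt_zero by (auto simp: d_def)
    define C where "C = cos d"
    have C: "C < 1" using cos_monotone_0_pi[of 0 d] d by (simp add: C_def)
    have bound: "norm (\<Psi> t * of_real (poisson_deriv r t)) \<le> e/2 * poisson_kernel r t + M * (2 * (1 - r\<^sup>2) / (1 - C)\<^sup>2)"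
      if r: "1/2 \<le> r" "r < 1" and t: "\<bar>t\<bar> \<le> pi" for r t
    proof (cases "\<bar>t\<bar> < d")
      case True
      have "norm (\<Psi> t * of_real (poisson_deriv r t)) \<le> (e/2 * \<bar>sin (t/2)\<bar>) * \<bar>poisson_deriv r t\<bar>"
        unfolding norm_mult norm_of_real by (intro mult_right_mono sm') (use True in \<open>auto simp: d_def\<close>)
      also have "\<dots> \<le> e/2 * poisson_kernel r t"
        using mult_left_mono[OF poisson_deriv_sin_le[of r t], of "e/2"] r e by (simp add: mult_ac)
      moreover have "0 \<le> M * (2 * (1 - r\<^sup>2) / (1 - C)\<^sup>2)"
        using M0 r by (auto intro!: mult_nonneg_nonneg divide_nonneg_nonneg simp: abs_square_le_1)
      ultimately show ?thesis by linarith
    next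
      case False
      have "cos t \<le> C"
      proof -
        have "cos \<bar>t\<bar> \<le> cos d" using False t d by (intro cos_monotone_0_pi_le) auto
        then show ?thesis by (simp add: C_def)
      qed
      then have "norm (\<Psi> t * of_real (poisson_deriv r t)) \<le> M * (2 * (1 - r\<^sup>2) / (1 - C)\<^sup>2)"
        unfolding norm_mult norm_of_real
        by (intro mult_mono \<Psi>_le poisson_deriv_away_le r C M0) auto
      moreover have "0 \<le> e/2 * poisson_kernel r t"
        using poisson_kernel_pos[of r t] r e by simp
      ultimately show ?thesis by linarith
    qed
    have est: "norm (S r - of_real r * D) \<le> e/2 + M * (2 * (1 - r\<^sup>2) / (1 - C)\<^sup>2)"
      if r: "1/2 \<le> r" "r < 1" for r
    proof -
      have r': "0 \<le> r" using r by simp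
      let ?B = "M * (2 * (1 - r\<^sup>2) / (1 - C)\<^sup>2)"
      have "2 * pi * norm (S r - of_real r * D) = norm (2 * pi * (S r - of_real r * D))"
        by (simp add: norm_mult)
      also have "\<dots> \<le> integral\<^sup>L (seg (-pi)) (\<lambda>t. norm (\<Psi> t * of_real (poisson_deriv r t)))"
        unfolding rep[OF r' r(2)] by (rule integral_norm_bound)
      also have "\<dots> \<le> integral\<^sup>L (seg (-pi)) (\<lambda>t. e/2 * poisson_kernel r t + ?B)"
      proof (rule integral_mono_AE)
        show "AE t in seg (-pi). norm (\<Psi> t * of_real (poisson_deriv r t)) \<le> e/2 * poisson_kernel r t + ?B"
          by (rule AE_segI) (use bound[OF r] in \<open>auto simp: abs_le_iff\<close>)
      qed (intro integrable_seg_continuous continuous_intros cont_\<Psi> continuous_poisson r' r)+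
      also have "\<dots> = e/2 * (2 * pi) + ?B * (2 * pi)"
        using integrable_seg_continuous[OF continuous_poisson(1)[OF r' r(2)], of "-pi"]
        by (simp add: integral_poisson_kernel[OF r' r(2), of _ 0, simplified] measure_seg)
      also have "\<dots> = 2 * pi * (e/2 + ?B)" by (simp add: algebra_simps)
      finally show ?thesis by simp
    qed
    have "((\<lambda>r. e/2 + M * (2 * (1 - r\<^sup>2) / (1 - C)\<^sup>2)) \<longlongrightarrow> e/2 + M * (2 * (1 - 1\<^sup>2) / (1 - C)\<^sup>2)) (at_left 1)"
      by (intro tendsto_intros) (use C in auto)
    then have "\<forall>\<^sub>F r in at_left 1. e/2 + M * (2 * (1 - r\<^sup>2) / (1 - C)\<^sup>2) < e"
      by (rule order_tendstoD) (use e in simp)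
    moreover have "\<forall>\<^sub>F r in at_left 1. (1/2::real) < r \<and> r < 1"
      using eventually_at_left_real[of "1/2" "1::real"] by simp
    ultimately show "\<forall>\<^sub>F r in at_left 1. dist (S r - of_real r * D) 0 < e"
    proof eventually_elim
      case (elim r)
      then show ?case using est[of r] by (simp add: dist_norm)
    qed
  qed
  moreover have "((\<lambda>r. of_real r * D) \<longlongrightarrow> of_real 1 * D) (at_left (1::real))"
    by (intro tendsto_intros)
  ultimately have "((\<lambda>r. (S r - of_real r * D) + of_real r * D) \<longlongrightarrow> 0 + of_real 1 * D) (at_left 1)"
    by (rule tendsto_add)
  then show ?thesis by (simp add: S_def)
qed

section \<open>Boundary values of functions in the Hardy space\<close>

text \<open>\<open>integrable_ccontinuous_explicit\<close> treats the averages over [x, x + h].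
  Applied to the reflected function it treats those over [x - h, x], and off both exceptional sets
  the two one-sided derivatives agree.\<close>

lemma lebesgue_differentiation:
  fixes f :: "real \<Rightarrow> complex"
  assumes f: "\<And>a b. f integrable_on {a..b}"
  obtains N where "negligible N"
    "\<And>x. x \<notin> N \<Longrightarrow> A < x \<Longrightarrow> ((\<lambda>y. integral {A..y} f) has_vector_derivative f x) (at x)"
proof -
  obtain N1 where N1: "negligible N1" "\<And>x e. \<lbrakk>x \<notin> N1; 0 < e\<rbrakk> \<Longrightarrow>
      \<exists>d>0. \<forall>h. 0 < h \<and> h < d \<longrightarrow> norm (integral {x..x + h} f /\<^sub>R h - f x) < e"
    using integrable_ccontinuous_explicit[of f] f by (auto simp: cbox_interval)
  have "(\<lambda>x. f (- x)) integrable_on {a..b}" for a b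
    using f[of "-b" "-a"] Henstock_Kurzweil_Integration.integrable_reflect_real[of f "-a" "-b"] by simp
  then obtain N2 where N2: "negligible N2" "\<And>x e. \<lbrakk>x \<notin> N2; 0 < e\<rbrakk> \<Longrightarrow>
      \<exists>d>0. \<forall>h. 0 < h \<and> h < d \<longrightarrow> norm (integral {x..x + h} (\<lambda>x. f (- x)) /\<^sub>R h - f (- x)) < e"
    using integrable_ccontinuous_explicit[of "\<lambda>x. f (- x)"] by (auto simp: cbox_interval)
  show ?thesis
  proof
    show "negligible (N1 \<union> uminus ` N2)"
      using N1(1) negligible_differentiable_image_negligible[OF _ N2(1), of uminus]
      by (auto intro!: derivative_intros differentiable_on_minus)
    fix x assume x: "x \<notin> N1 \<union> uminus ` N2" "A < x"
    then have x1: "x \<notin> N1" and x2: "- x \<notin> N2" by (auto simp: image_iff)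
    show "((\<lambda>y. integral {A..y} f) has_vector_derivative f x) (at x)"
      unfolding has_vector_derivative_def has_derivative_within_alt2
    proof (intro conjI allI impI)
      show "bounded_linear (\<lambda>h. h *\<^sub>R f x)" by (rule bounded_linear_scaleR_left)
      fix e :: real assume e: "e > 0"
      obtain d1 where d1: "d1 > 0" "\<And>h. 0 < h \<Longrightarrow> h < d1 \<Longrightarrow> norm (integral {x..x + h} f /\<^sub>R h - f x) < e"
        using N1(2)[OF x1 e] by blast
      obtain d2 where d2: "d2 > 0" "\<And>h. 0 < h \<Longrightarrow> h < d2 \<Longrightarrow> norm (integral {-x..-x + h} (\<lambda>x. f (- x)) /\<^sub>R h - f x) < e"
        using N2(2)[OF x2 e] by auto
      have "norm (integral {A..y} f - integral {A..x} f - (y - x) *\<^sub>R f x) \<le> e * norm (y - x)"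
        if y: "y \<noteq> x" "\<bar>y - x\<bar> < min (min d1 d2) (x - A)" for y
      proof (cases "y > x")
        case True
        define h where "h = y - x"
        have h: "0 < h" "h < d1" "y = x + h" using True y by (auto simp: h_def)
        have "integral {A..y} f = integral {A..x} f + integral {x..y} f"
          by (rule Henstock_Kurzweil_Integration.integral_combine[symmetric]) (use x True f in auto)
        then have "norm (integral {A..y} f - integral {A..x} f - (y - x) *\<^sub>R f x)
            = norm (h *\<^sub>R (integral {x..x + h} f /\<^sub>R h - f x))"
          using h by (simp add: scaleR_diff_right)
        also have "\<dots> \<le> h * e" using d1(2)[OF h(1,2)] h(1) by simp
        finally show ?thesis using h by (simp add: mult.commute)
      next
        case False
        define h where "h = x - y"
        have h: "0 < h" "h < d2" "y = x - h" using False y by (auto simp: h_def)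
        have "integral {A..x} f = integral {A..y} f + integral {y..x} f"
          by (rule Henstock_Kurzweil_Integration.integral_combine[symmetric]) (use x False f y in auto)
        moreover have "integral {-x..-x + h} (\<lambda>x. f (- x)) = integral {y..x} f"
        proof -
          have "- x + h = - y" using h by simp
          then show ?thesis by (simp only: Henstock_Kurzweil_Integration.integral_reflect_real)
        qed
        ultimately have "norm (integral {A..y} f - integral {A..x} f - (y - x) *\<^sub>R f x)
            = norm (- (h *\<^sub>R (integral {-x..-x + h} (\<lambda>x. f (- x)) /\<^sub>R h - f x)))"
          using h by (simp add: scaleR_diff_right)
        also have "\<dots> \<le> h * e" using d2(2)[OF h(1,2)] h(1) by simp
        finally show ?thesis using h by (simp add: mult.commute)
      qed
      then show "\<forall>\<^sub>F y in at x. norm (integral {A..y} f - integral {A..x} f - (y - x) *\<^sub>R f x) \<le> e * norm (y - x)"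
        unfolding eventually_at using d1 d2 x
        by (intro exI[of _ "min (min d1 d2) (x - A)"]) (auto simp: dist_real_def)
    qed
  qed
qed

section \<open>Riesz-Fischer limits along lacunary partial sums\<close>

lemma fast_tail_indices:
  fixes x :: "nat \<Rightarrow> real"
  assumes "summable x" "\<And>j. 0 < e j"
  obtains N :: "nat \<Rightarrow> nat" where "strict_mono N" "\<And>j m. sum x {N j..<m} \<le> e j"
proof -
  have "\<exists>K. \<forall>m\<ge>K. \<forall>n. norm (sum x {m..<n}) < e j" for j
    using assms unfolding summable_Cauchy by blast
  then obtain K where K: "\<And>j m n. m \<ge> K j \<Longrightarrow> norm (sum x {m..<n}) < e j" by metis
  define N where "N = (\<lambda>j. \<Sum>i\<le>j. Suc (K i))"
  have "N j \<ge> K j" for j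
    unfolding N_def using member_le_sum[of j "{..j}" "\<lambda>i. Suc (K i)"] by simp
  then have "sum x {N j..<m} \<le> e j" for j m using K[of j "N j" m] by (simp add: abs_le_iff)
  moreover have "strict_mono N" by (rule strict_monoI_Suc) (simp add: N_def)
  ultimately show ?thesis using that by blast
qed

text \<open>By monotone convergence the sum has finite integral, so it is finite almost
  everywhere.\<close>

lemma AE_summable_of_summable_integral:
  fixes w :: "nat \<Rightarrow> 'a \<Rightarrow> real"
  assumes int: "\<And>j. integrable M (w j)" and nonneg: "\<And>j x. 0 \<le> w j x"
    and sum: "summable (\<lambda>j. integral\<^sup>L M (w j))"
  shows "AE x in M. summable (\<lambda>j. w j x)"
proof -
  have "(\<integral>\<^sup>+x. (\<Sum>j. ennreal (w j x)) \<partial>M) = (\<Sum>j. \<integral>\<^sup>+x. ennreal (w j x) \<partial>M)"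
    using int by (intro nn_integral_suminf) auto
  also have "\<dots> = (\<Sum>j. ennreal (integral\<^sup>L M (w j)))"
    using int nonneg by (simp add: nn_integral_eq_integral)
  also have "\<dots> = ennreal (\<Sum>j. integral\<^sup>L M (w j))"
    using sum nonneg by (intro suminf_ennreal2) auto
  finally have "(\<integral>\<^sup>+x. (\<Sum>j. ennreal (w j x)) \<partial>M) \<noteq> \<infinity>" by simp
  then have "AE x in M. (\<Sum>j. ennreal (w j x)) \<noteq> \<infinity>"
    using int by (intro nn_integral_noteq_infinite) auto
  then show ?thesis
    using nonneg by (auto elim!: eventually_mono intro!: summable_suminf_not_top)
qed

lemma integral_seg_parseval_finite:
  fixes b :: "nat \<Rightarrow> complex"
  assumes "finite A"
  shows "integral\<^sup>L (seg a) (\<lambda>t. (cmod (\<Sum>n\<in>A. b n * cis (n * t)))\<^sup>2) = 2 * pi * (\<Sum>n\<in>A. (cmod (b n))\<^sup>2)"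
proof -
  define c where "c = (\<lambda>n. if n \<in> A then b n else 0)"
  have "summable (\<lambda>n. norm (c n))"
    by (rule summable_finite[OF assms]) (simp add: c_def)
  from integral_seg_parseval_norm[OF this, of a]
  have *: "(\<lambda>n. 2 * pi * (cmod (c n))\<^sup>2) sums integral\<^sup>L (seg a) (\<lambda>t. (cmod (\<Sum>n. c n * cis (n * t)))\<^sup>2)" .
  have "(\<Sum>n. c n * cis (n * t)) = (\<Sum>n\<in>A. b n * cis (n * t))" for t :: real
    by (subst suminf_finite[OF assms]) (auto simp: c_def)
  moreover have "(\<Sum>n. 2 * pi * (cmod (c n))\<^sup>2) = 2 * pi * (\<Sum>n\<in>A. (cmod (b n))\<^sup>2)"
    by (subst suminf_finite[OF assms]) (auto simp: c_def sum_distrib_left)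
  ultimately show ?thesis using * by (simp add: sums_iff)
qed

text \<open>Riesz--Fischer along a lacunary subsequence, with an integrable majorant of the squares so
  that dominated convergence yields both the norm of the limit and its integrals.\<close>

lemma fourier_subsequence_limit:
  fixes b :: "nat \<Rightarrow> complex"
  assumes b: "summable (\<lambda>n. (cmod (b n))\<^sup>2)"
  obtains N :: "nat \<Rightarrow> nat" and u :: "real \<Rightarrow> complex" and W :: "real \<Rightarrow> real"
  where "strict_mono N" "u \<in> borel_measurable (seg a)" "integrable (seg a) W"
    "AE t in seg a. (\<lambda>j. \<Sum>n<N j. b n * cis (n * t)) \<longlonglongrightarrow> u t"
    "AE t in seg a. \<forall>j. (cmod (\<Sum>n<N j. b n * cis (n * t)))\<^sup>2 \<le> W t"
proof -
  \<comment> \<open>A block energy of 16^-j survives the weight 4^j inside \<open>w\<close> and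
    still leaves 4^-j, which is summable.\<close>
  obtain N where N: "strict_mono N" "\<And>j m. (\<Sum>n\<in>{N j..<m}. (cmod (b n))\<^sup>2) \<le> (1/16)^j"
    using fast_tail_indices[OF b, of "\<lambda>j. (1/16)^j"] by auto
  define S where "S = (\<lambda>j (t::real). \<Sum>n<N j. b n * cis (n * t))"
  define v where "v = (\<lambda>j (t::real). \<Sum>n\<in>{N j..<N (Suc j)}. b n * cis (n * t))"
  define w where "w = (\<lambda>j t. (2^j * cmod (v j t))\<^sup>2)"
  define u where "u = (\<lambda>t. S 0 t + (\<Sum>j. v j t))"
  \<comment> \<open>From (x + y)^2 \<le> 2 x^2 + 2 y^2 with y the sum of the block moduli;
    Cauchy-Schwarz bounds y^2 by twice the sum of the \<open>w j\<close>, whence the factor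
    4.\<close>
  define W where "W = (\<lambda>t. 2 * (cmod (S 0 t))\<^sup>2 + 4 * (\<Sum>j. w j t))"
  have quarter: "((1/2::real)^j)\<^sup>2 = (1/4)^j" for j
    by (simp add: power2_eq_square power_mult_distrib[symmetric])
  have cont: "continuous_on UNIV (v j)" "continuous_on UNIV (S j)" for j
    unfolding v_def S_def by (intro continuous_intros)+
  have S_eq: "S j t = S 0 t + (\<Sum>i<j. v i t)" for j t
  proof (induction j)
    case (Suc j)
    have "{..<N (Suc j)} = {..<N j} \<union> {N j..<N (Suc j)}"
      using N(1) by (auto simp: strict_mono_def) (meson lessI less_trans)
    then have "S (Suc j) t = S j t + v j t"
      unfolding S_def v_def by (simp add: sum.union_disjoint disjoint_iff)
    then show ?case using Suc by simp
  qed simp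
  have int_w: "integrable (seg a) (w j)" for j
    unfolding w_def by (intro integrable_seg_continuous continuous_intros cont)
  have int_w_le: "integral\<^sup>L (seg a) (w j) \<le> 2 * pi * (1/4)^j" for j
  proof -
    have "integral\<^sup>L (seg a) (w j) = 4^j * (2 * pi * (\<Sum>n\<in>{N j..<N (Suc j)}. (cmod (b n))\<^sup>2))"
      unfolding w_def v_def
      by (simp add: power_mult_distrib integral_seg_parseval_finite power_even_eq[symmetric] power_mult)
    also have "\<dots> \<le> 4^j * (2 * pi * (1/16)^j)" by (intro mult_left_mono N(2)) auto
    also have "(4::real)^j * (2 * pi * (1/16)^j) = 2 * pi * (1/4)^j"
      by (simp add: power_mult_distrib[symmetric])
    finally show ?thesis .
  qed
  have w0: "w j t \<ge> 0" for j t by (simp add: w_def)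
  have sum_int: "summable (\<lambda>j. integral\<^sup>L (seg a) (w j))"
  proof (rule summable_comparison_test')
    show "summable (\<lambda>j. 2 * pi * (1/4::real)^j)" by (intro summable_mult summable_geometric) simp
    show "norm (integral\<^sup>L (seg a) (w j)) \<le> 2 * pi * (1/4)^j" for j
      using int_w_le[of j] w0 by (simp add: integral_nonneg_AE)
  qed
  have AE_w: "AE t in seg a. summable (\<lambda>j. w j t)"
    by (rule AE_summable_of_summable_integral[OF int_w w0 sum_int])
  have int_sum_w: "integrable (seg a) (\<lambda>t. \<Sum>j. w j t)"
    by (rule integrable_suminf[OF int_w]) (use AE_w w0 sum_int in auto)
  show ?thesis
  proof
    show "strict_mono N" by (rule N)
    show "u \<in> borel_measurable (seg a)"
      unfolding u_def by (intro borel_measurable_add borel_measurable_suminf seg_measurable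
          borel_measurable_continuous_onI cont)
    show "integrable (seg a) W"
      unfolding W_def by (intro Bochner_Integration.integrable_add integrable_mult_right int_sum_w
          integrable_seg_continuous continuous_intros cont)
    show "AE t in seg a. (\<lambda>j. \<Sum>n<N j. b n * cis (n * t)) \<longlonglongrightarrow> u t"
      using AE_w
    proof eventually_elim
      case (elim t)
      have "summable (\<lambda>j. v j t)"
      proof (rule summable_comparison_test')
        show "summable (\<lambda>j. ((1/4)^j + w j t) / 2)"
          by (intro summable_divide summable_add summable_geometric elim) simp
        show "norm (v j t) \<le> ((1/4)^j + w j t) / 2" for j
        proof -
          \<comment> \<open>The arithmetic-geometric mean inequality with reciprocal weights: the
            cross term is just twice the modulus of the block.\<close>
          have "0 \<le> ((1/2)^j - 2^j * cmod (v j t))\<^sup>2" by simp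
          also have "\<dots> = ((1/2)^j)\<^sup>2 + w j t - 2 * ((1/2)^j * 2^j) * cmod (v j t)"
            unfolding w_def power2_diff by simp
          also have "((1/2::real)^j)\<^sup>2 = (1/4)^j" by (rule quarter)
          also have "(1/2::real)^j * 2^j = 1" by (simp add: power_mult_distrib[symmetric])
          finally show ?thesis by simp
        qed
      qed
      then have "(\<lambda>j. S 0 t + (\<Sum>i<j. v i t)) \<longlonglongrightarrow> u t"
        unfolding u_def by (intro tendsto_intros summable_LIMSEQ)
      then show ?case unfolding S_eq[symmetric] by (simp add: S_def)
    qed
    show "AE t in seg a. \<forall>j. (cmod (\<Sum>n<N j. b n * cis (n * t)))\<^sup>2 \<le> W t"
      using AE_w
    proof eventually_elim
      case (elim t)
      show ?case
      proof
        fix j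
        have "(\<Sum>i<j. cmod (v i t))\<^sup>2 = (\<Sum>i<j. (1/2)^i * (2^i * cmod (v i t)))\<^sup>2"
          by (simp add: power_one_over)
        also have "\<dots> \<le> (\<Sum>i<j. ((1/2)^i)\<^sup>2) * (\<Sum>i<j. (2^i * cmod (v i t))\<^sup>2)"
          by (rule Cauchy_Schwarz_ineq_sum)
        also have "(\<Sum>i<j. (2^i * cmod (v i t))\<^sup>2) = (\<Sum>i<j. w i t)"
          by (simp add: w_def)
        also have "(\<Sum>i<j. ((1/2::real)^i)\<^sup>2) = (\<Sum>i<j. (1/4)^i)"
          by (simp only: quarter)
        also have "(\<Sum>i<j. (1/4::real)^i) * (\<Sum>i<j. w i t) \<le> 2 * (\<Sum>i. w i t)"
        proof (intro mult_mono sum_le_suminf elim)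
          have "(\<Sum>i<j. (1/4::real)^i) \<le> (\<Sum>i. (1/4)^i)"
            by (intro sum_le_suminf summable_geometric) auto
          also have "\<dots> \<le> 2" by (simp add: suminf_geometric)
          finally show "(\<Sum>i<j. (1/4::real)^i) \<le> 2" .
        qed (auto simp: w0 sum_nonneg)
        finally have *: "(\<Sum>i<j. cmod (v i t))\<^sup>2 \<le> 2 * (\<Sum>i. w i t)" .
        have "cmod (S j t) \<le> cmod (S 0 t) + (\<Sum>i<j. cmod (v i t))"
          unfolding S_eq[of j] by (rule norm_triangle_mono[OF order_refl norm_sum])
        then have "(cmod (S j t))\<^sup>2 \<le> (cmod (S 0 t) + (\<Sum>i<j. cmod (v i t)))\<^sup>2" by (intro power_mono) auto
        also have "\<dots> \<le> 2 * (cmod (S 0 t))\<^sup>2 + 2 * (\<Sum>i<j. cmod (v i t))\<^sup>2"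
          using sum_squares_bound[of "cmod (S 0 t)" "\<Sum>i<j. cmod (v i t)"] by (simp add: power2_sum)
        finally show "(cmod (\<Sum>n<N j. b n * cis (n * t)))\<^sup>2 \<le> W t"
          using * unfolding W_def S_def by simp
      qed
    qed
  qed
qed

text \<open>Replacing \<open>boundary_val\<close> by an almost everywhere equal function under the
  integral requires its measurability. This is shown without knowing where radial limits exist: the
  Cauchy criterion makes the set of convergence Borel, and on it the limit may be taken along a
  sequence of radii.\<close>

lemma boundary_val_measurable:
  assumes g: "g holomorphic_on ball 0 1"
  shows "boundary_val g \<in> borel_measurable borel"
proof -
  define G where "G = (\<lambda>r \<theta>. g (of_real r * cis \<theta>))"
  \<comment> \<open>The Cauchy criterion with countably many tolerances and distances from the
    circle. The radii \<open>p\<close>, \<open>q\<close> range over a continuum, which is harmless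
    because an arbitrary intersection of closed conditions is closed.\<close>
  define Z where "Z = (\<lambda>k m. {\<theta>. \<forall>p\<in>{1 - 1/(real m+1)<..<1}. \<forall>q\<in>{1 - 1/(real m+1)<..<1}. cmod (G p \<theta> - G q \<theta>) \<le> 1 / (real k + 1)})"
  define C where "C = (\<Inter>k. \<Union>m. Z k m)"
  have contG: "continuous_on UNIV (G p)" if "0 \<le> p" "p < 1" for p
    unfolding G_def using that
    by (intro continuous_on_compose2[OF holomorphic_on_imp_continuous_on[OF g]] continuous_intros)
       (auto simp: norm_mult)
  have m01: "0 < p \<and> p < 1" if "p \<in> {1 - 1/(real m+1)<..<1}" for p m
  proof -
    have "1/(real m+1) \<le> 1" by simp
    then show ?thesis using that unfolding greaterThanLessThan_iff by linarith
  qed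
  have "closed (Z k m)" for k m
  proof -
    have "Z k m = (\<Inter>p\<in>{1 - 1/(real m+1)<..<1}. \<Inter>q\<in>{1 - 1/(real m+1)<..<1}. {\<theta>. cmod (G p \<theta> - G q \<theta>) \<le> 1 / (real k + 1)})"
      by (auto simp: Z_def)
    also have "closed \<dots>"
      by (intro closed_INT ballI closed_Collect_le continuous_intros contG) (use m01 less_imp_le in blast)+
    finally show ?thesis .
  qed
  then have C_borel: "C \<in> sets borel" unfolding C_def by (intro sets.countable_INT' sets.countable_UN) (auto intro: borel_closed)
  define R where "R = (\<lambda>n. 1 - 1/(real n+2))"
  have R01: "0 \<le> R n" "R n < 1" for n by (auto simp: R_def field_simps)
  have R_lim: "filterlim R (at_left 1) sequentially"
  proof (rule tendsto_imp_filterlim_at_left)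
    have "(\<lambda>n. 1 - 1/real (n+2)) \<longlonglongrightarrow> 1 - 0"
      by (intro tendsto_intros LIMSEQ_ignore_initial_segment lim_1_over_n)
    then show "R \<longlonglongrightarrow> 1" by (simp add: R_def add.commute)
  qed (use R01 in auto)
  have conv_imp: "\<theta> \<in> C" if "((\<lambda>r. G r \<theta>) \<longlongrightarrow> l) (at_left 1)" for \<theta> l
    unfolding C_def
  proof (intro INT_I)
    fix k
    have "\<forall>\<^sub>F r in at_left 1. dist (G r \<theta>) l < 1 / (2 * (real k + 1))"
      using that by (rule tendstoD) simp
    then obtain d where d: "d < 1" "\<And>r. d < r \<Longrightarrow> r < 1 \<Longrightarrow> dist (G r \<theta>) l < 1 / (2 * (real k + 1))"
      unfolding eventually_at_left[OF zero_less_one] by auto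
    obtain m where m: "1 / real (Suc m) < 1 - d" using d(1) by (meson diff_gt_0_iff_gt nat_approx_posE)
    have "cmod (G p \<theta> - G q \<theta>) \<le> 1 / (real k + 1)" if "p \<in> {1 - 1/(real m+1)<..<1}" "q \<in> {1 - 1/(real m+1)<..<1}" for p q
    proof -
      have "cmod (G p \<theta> - G q \<theta>) \<le> dist (G p \<theta>) l + dist (G q \<theta>) l"
        by (metis dist_norm dist_triangle2)
      also have "\<dots> \<le> 1 / (2 * (real k + 1)) + 1 / (2 * (real k + 1))"
        using that m by (intro add_mono less_imp_le[OF d(2)]) (auto simp: add.commute)
      also have "\<dots> = 1 / (real k + 1)" by (simp add: field_simps)
      finally show ?thesis .
    qed
    then show "\<theta> \<in> (\<Union>m. Z k m)" unfolding Z_def by blast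
  qed
  have conv: "((\<lambda>r. G r \<theta>) \<longlongrightarrow> lim (\<lambda>n. G (R n) \<theta>)) (at_left 1)" if \<theta>: "\<theta> \<in> C" for \<theta>
  proof -
    have ev: "\<forall>\<^sub>F r in at_left 1. r \<in> {1 - 1/(real m+1)<..<1}" for m
      using eventually_at_left_real[of "1 - 1/(real m+1)" 1] by simp
    have "Cauchy (\<lambda>n. G (R n) \<theta>)"
      unfolding Cauchy_altdef2
    proof (intro allI impI)
      fix e :: real assume "e > 0"
      then obtain k where k: "1 / real (Suc k) < e" using nat_approx_posE by blast
      obtain m where m: "\<theta> \<in> Z k m" using \<theta> by (auto simp: C_def)
      obtain n0 where n0: "\<And>n. n \<ge> n0 \<Longrightarrow> R n \<in> {1 - 1/(real m+1)<..<1}"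
        using filterlim_iff[THEN iffD1, OF R_lim] ev[of m] unfolding eventually_sequentially by blast
      have "dist (G (R n) \<theta>) (G (R n0) \<theta>) < e" if "n \<ge> n0" for n
      proof -
        have "dist (G (R n) \<theta>) (G (R n0) \<theta>) \<le> 1 / (real k + 1)"
          using m n0[OF that] n0[OF order_refl] unfolding Z_def dist_norm by blast
        then show ?thesis using k by (simp add: add.commute)
      qed
      then show "\<exists>N. \<forall>n\<ge>N. dist (G (R n) \<theta>) (G (R N) \<theta>) < e" by blast
    qed
    then have L: "(\<lambda>n. G (R n) \<theta>) \<longlonglongrightarrow> lim (\<lambda>n. G (R n) \<theta>)"
      by (simp add: Cauchy_convergent convergent_LIMSEQ_iff[symmetric])
    show ?thesis
    proof (rule tendstoI)
      fix e :: real assume "e > 0"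
      then obtain k where k: "1 / real (Suc k) < e" using nat_approx_posE by blast
      obtain m where m: "\<theta> \<in> Z k m" using \<theta> by (auto simp: C_def)
      from ev[of m] show "\<forall>\<^sub>F r in at_left 1. dist (G r \<theta>) (lim (\<lambda>n. G (R n) \<theta>)) < e"
      proof eventually_elim
        case (elim r)
        have "norm (G r \<theta> - lim (\<lambda>n. G (R n) \<theta>)) \<le> 1 / (real k + 1)"
        proof (rule tendsto_upperbound)
          show "(\<lambda>n. norm (G r \<theta> - G (R n) \<theta>)) \<longlonglongrightarrow> norm (G r \<theta> - lim (\<lambda>n. G (R n) \<theta>))"
            by (intro tendsto_intros L)
          have "\<forall>\<^sub>F n in sequentially. R n \<in> {1 - 1/(real m+1)<..<1}"
            using filterlim_iff[THEN iffD1, OF R_lim] ev[of m] by blast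
          then show "\<forall>\<^sub>F n in sequentially. norm (G r \<theta> - G (R n) \<theta>) \<le> 1 / (real k + 1)"
            by eventually_elim (use m elim in \<open>auto simp: Z_def\<close>)
        qed simp
        then show ?case using k by (simp add: dist_norm add.commute)
      qed
    qed
  qed
  \<comment> \<open>Off \<open>C\<close> the definite description inside \<open>Lim\<close> has no
    witness, so \<open>boundary_val\<close> has the same value \<open>THE l. False\<close> at all
    those angles.\<close>
  have "boundary_val g = (\<lambda>\<theta>. if \<theta> \<in> C then lim (\<lambda>n. G (R n) \<theta>) else (THE l. False))"
  proof
    fix \<theta>
    show "boundary_val g \<theta> = (if \<theta> \<in> C then lim (\<lambda>n. G (R n) \<theta>) else (THE l. False))"
    proof (cases "\<theta> \<in> C")
      case True
      then show ?thesis unfolding boundary_val_def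
        using tendsto_Lim[OF _ conv[OF True]] by (simp add: G_def)
    next
      case False
      then have "\<not> ((\<lambda>r. G r \<theta>) \<longlongrightarrow> l) (at_left 1)" for l using conv_imp by blast
      then show ?thesis using False unfolding boundary_val_def Topological_Spaces.Lim_def by (simp add: G_def)
    qed
  qed
  moreover have "(\<lambda>\<theta>. lim (\<lambda>n. G (R n) \<theta>)) \<in> borel_measurable borel"
    by (intro borel_measurable_lim_metric borel_measurable_continuous_onI contG R01)
  ultimately show ?thesis using C_borel by (simp add: measurable_If_set)
qed

section \<open>Radial limits as derivatives of primitives\<close>

lemma set_integral_subseg:
  fixes f :: "real \<Rightarrow> 'a::{banach, second_countable_topology}"
  assumes "y \<le> a + 2*pi"
  shows "(LINT t:{a..y}|lborel. f t) = integral\<^sup>L (seg a) (\<lambda>t. indicator {a..y} t *\<^sub>R f t)"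
proof -
  have *: "indicator {a..a+2*pi} t *\<^sub>R (indicator {a..y} t *\<^sub>R f t) = indicator {a..y} t *\<^sub>R f t" for t
    using assms by (auto simp: indicator_def)
  then show ?thesis
    unfolding set_integral_seg[symmetric] set_lebesgue_integral_def by (simp only: *)
qed

lemma set_integral_cis_sum:
  fixes b :: "nat \<Rightarrow> complex"
  assumes "a \<le> y"
  shows "(LINT t:{a..y}|lborel. \<Sum>n<N. b n * cis (n * t)) =
    (\<Sum>n<N. if n = 0 then b 0 * of_real (y - a) else b n / (\<i> * n) * (cis (n * y) - cis (n * a)))"
proof -
  define F where "F = (\<lambda>t::real. \<Sum>n<N. if n = 0 then b 0 * of_real t else b n / (\<i> * n) * cis (n * t))"
  have "(F has_vector_derivative (\<Sum>n<N. b n * cis (n * t))) (at t within {a..y})" for t :: real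
    unfolding F_def
  proof (rule has_vector_derivative_sum)
    fix n
    show "((\<lambda>t. if n = 0 then b 0 * of_real t else b n / (\<i> * n) * cis (n * t)) has_vector_derivative b n * cis (n * t)) (at t within {a..y})"
    proof (cases "n = 0")
      case True
      have "((\<lambda>t. complex_of_real t) has_vector_derivative of_real 1) (at t within {a..y})"
        by (intro has_vector_derivative_of_real) (rule DERIV_ident)
      from has_vector_derivative_mult_right[OF this, of "b 0"] True show ?thesis by simp
    next
      case False
      from has_vector_derivative_mult_right[OF has_vector_derivative_cis[of "real n" t "{a..y}"], of "b n / (\<i> * n)"] False
      show ?thesis by simp
    qed
  qed
  then have "has_bochner_integral lborel (\<lambda>t. indicator {a..y} t *\<^sub>R (\<Sum>n<N. b n * cis (n * t))) (F y - F a)"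
    by (intro has_bochner_integral_FTC_Icc assms) (auto intro!: continuous_intros)
  then have "(LINT t:{a..y}|lborel. \<Sum>n<N. b n * cis (n * t)) = F y - F a"
    unfolding set_lebesgue_integral_def by (rule has_bochner_integral_integral_eq)
  also have "\<dots> = (\<Sum>n<N. if n = 0 then b 0 * of_real (y - a) else b n / (\<i> * n) * (cis (n * y) - cis (n * a)))"
    unfolding F_def sum_subtractf[symmetric] by (intro sum.cong) (auto simp: algebra_simps)
  finally show ?thesis .
qed

text \<open>Extension by zero makes \<open>u\<close> integrable on every interval, as Lebesgue
  differentiation demands; the endpoints are discarded with the exceptional set. That set is null
  for the completed measure, and \<open>AE_completion_iff\<close> returns to
  \<open>lborel\<close>.\<close>

lemma AE_has_vector_derivative_integral:
  fixes u :: "real \<Rightarrow> complex"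
  assumes u: "integrable (seg a) u"
  shows "AE x in seg a. ((\<lambda>y. LINT t:{a..y}|lborel. u t) has_vector_derivative u x) (at x)"
proof -
  define f where "f = (\<lambda>x. indicator {a..a+2*pi} x *\<^sub>R u x)"
  have int_f: "integrable lborel f"
    using u unfolding f_def seg_def by (simp add: integrable_restrict_space)
  then have set_int: "set_integrable lborel S f" if "S \<in> sets borel" for S
    unfolding set_integrable_def using that by (intro integrable_mult_indicator) auto
  obtain N where N: "negligible N"
    "\<And>x. x \<notin> N \<Longrightarrow> a < x \<Longrightarrow> ((\<lambda>y. integral {a..y} f) has_vector_derivative f x) (at x)"
    using lebesgue_differentiation[of f a] set_borel_integral_eq_integral(1)[OF set_int] by auto
  have deriv: "((\<lambda>y. LINT t:{a..y}|lborel. u t) has_vector_derivative u x) (at x)"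
    if x: "x \<notin> N" "a < x" "x < a + 2*pi" for x
  proof (rule has_vector_derivative_transform_within_open[where S = "{a<..<a+2*pi}"])
    show "((\<lambda>y. integral {a..y} f) has_vector_derivative u x) (at x)"
      using N(2)[OF x(1,2)] x by (simp add: f_def)
    fix y assume y: "y \<in> {a<..<a+2*pi}"
    have "integral {a..y} f = (LINT t:{a..y}|lborel. f t)"
      using set_borel_integral_eq_integral(2)[OF set_int, of "{a..y}"] by simp
    also have "\<dots> = (LINT t:{a..y}|lborel. u t)"
      by (rule set_lebesgue_integral_cong) (use y in \<open>auto simp: f_def\<close>)
    finally show "integral {a..y} f = (LINT t:{a..y}|lborel. u t)" .
  qed (use x in auto)
  have "N \<union> {a, a+2*pi} \<in> null_sets lebesgue"
    using N(1) by (simp add: negligible_iff_null_sets[symmetric] negligible_Un)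
  from AE_not_in[OF this] have *: "AE x in lborel. x \<notin> N \<union> {a, a+2*pi}"
    by (simp only: AE_completion_iff)
  then show ?thesis
    by (intro AE_segI eventually_mono[OF *]) (use deriv in auto)
qed

text \<open>Twice the term is at most |b n|^2 + 1/n^2; at n = 0 division by zero makes the term 0.
  This is what gives primitives of \<open>H2\<close> functions absolutely convergent series.\<close>

lemma summable_div_of_square_summable:
  fixes b :: "nat \<Rightarrow> complex"
  assumes "summable (\<lambda>n. (cmod (b n))\<^sup>2)"
  shows "summable (\<lambda>n. cmod (b n) / n)"
proof (rule summable_comparison_test')
  show "summable (\<lambda>n. (cmod (b n))\<^sup>2 + 1 / real n ^ 2)"
    by (intro summable_add assms inverse_power_summable[of 2, simplified inverse_eq_divide]) simp
  fix n :: nat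
  define q where "q = cmod (b n) / n"
  have "2 * q \<le> (cmod (b n))\<^sup>2 + 1 / real n ^ 2"
    using sum_squares_bound[of "cmod (b n)" "1 / n"] by (simp add: q_def power_divide)
  moreover have "0 \<le> q" by (simp add: q_def)
  ultimately show "norm (cmod (b n) / n) \<le> (cmod (b n))\<^sup>2 + 1 / real n ^ 2"
    unfolding q_def[symmetric] by simp
qed

lemma integrable_of_square_le:
  fixes u :: "real \<Rightarrow> complex"
  assumes "u \<in> borel_measurable (seg a)" "integrable (seg a) W" "AE t in seg a. (cmod (u t))\<^sup>2 \<le> W t"
  shows "integrable (seg a) u"
proof (rule Bochner_Integration.integrable_bound)
  show "integrable (seg a) (\<lambda>t. 1 + W t)"
    using assms(2) by simp
  show "AE t in seg a. norm (u t) \<le> norm (1 + W t)"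
    using assms(3)
  proof eventually_elim
    case (elim t)
    have "cmod (u t) \<le> 1 + (cmod (u t))\<^sup>2"
      using sum_squares_bound[of 1 "cmod (u t)"] norm_ge_zero[of "u t"] by (simp only: power_one)
    then show ?case using elim by simp
  qed
qed (rule assms(1))

text \<open>Riesz-Fischer yields a limit function \<open>u\<close> of the right norm, while
  \<open>H2_norm\<close> is about radial limits, so \<open>u\<close> has to be identified with
  \<open>boundary_val g\<close>. The periodic primitive \<open>\<Phi>\<close> of the series without
  its constant term is, almost everywhere, differentiable with derivative \<open>u - b 0\<close>,
  and Abel summation at such points gives the radial limit of \<open>g\<close>.\<close>

lemma H2_norm_sums:
  assumes gH2: "g \<in> H2"
  shows "(\<lambda>n. (cmod (taylor_coeff g n))\<^sup>2) sums (H2_norm g)\<^sup>2"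
proof -
  have g: "g holomorphic_on ball 0 1" using gH2 by (simp add: H2_def)
  define b where "b = taylor_coeff g"
  have b: "summable (\<lambda>n. (cmod (b n))\<^sup>2)" unfolding b_def by (rule H2_coeff_square_summable[OF gH2])
  define S where "S = (\<lambda>m (t::real). \<Sum>n<m. b n * cis (n * t))"
  obtain N u W where N: "strict_mono N" and u: "u \<in> borel_measurable (seg 0)" and W: "integrable (seg 0) W"
    and lim: "AE t in seg 0. (\<lambda>j. S (N j) t) \<longlonglongrightarrow> u t"
    and bound: "AE t in seg 0. \<forall>j. (cmod (S (N j) t))\<^sup>2 \<le> W t"
    unfolding S_def by (rule fourier_subsequence_limit[OF b, of 0]) blast
  have contS: "continuous_on UNIV (S m)" for m unfolding S_def by (intro continuous_intros)
  have S_meas: "S m \<in> borel_measurable (seg 0)" for m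
    by (intro seg_measurable borel_measurable_continuous_onI contS)
  have u_le: "AE t in seg 0. (cmod (u t))\<^sup>2 \<le> W t"
    using lim bound
  proof eventually_elim
    case (elim t)
    show ?case
      by (rule tendsto_upperbound[OF tendsto_power[OF tendsto_norm[OF elim(1)]]]) (use elim(2) in auto)
  qed
  have N_lim: "filterlim N sequentially sequentially" by (rule filterlim_subseq[OF N])

  have "(\<lambda>j. integral\<^sup>L (seg 0) (\<lambda>t. (cmod (S (N j) t))\<^sup>2)) \<longlonglongrightarrow> integral\<^sup>L (seg 0) (\<lambda>t. (cmod (u t))\<^sup>2)"
  proof (rule integral_dominated_convergence[OF _ _ W])
    show "AE t in seg 0. (\<lambda>j. (cmod (S (N j) t))\<^sup>2) \<longlonglongrightarrow> (cmod (u t))\<^sup>2"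
      using lim by eventually_elim (intro tendsto_intros)
    show "AE t in seg 0. norm ((cmod (S (N j) t))\<^sup>2) \<le> W t" for j
      using bound by eventually_elim auto
  qed (use u S_meas in measurable)
  then have lim1: "(\<lambda>j. 2 * pi * (\<Sum>n<N j. (cmod (b n))\<^sup>2)) \<longlonglongrightarrow> integral\<^sup>L (seg 0) (\<lambda>t. (cmod (u t))\<^sup>2)"
    unfolding S_def by (simp add: integral_seg_parseval_finite)
  have lim2: "(\<lambda>j. 2 * pi * (\<Sum>n<N j. (cmod (b n))\<^sup>2)) \<longlonglongrightarrow> 2 * pi * (\<Sum>n. (cmod (b n))\<^sup>2)"
    by (intro tendsto_intros filterlim_compose[OF summable_LIMSEQ[OF b] N_lim])
  have norm_u: "integral\<^sup>L (seg 0) (\<lambda>t. (cmod (u t))\<^sup>2) = 2 * pi * (\<Sum>n. (cmod (b n))\<^sup>2)"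
    by (rule LIMSEQ_unique[OF lim1 lim2])

  \<comment> \<open>\<open>c 0\<close> is 0 because division by zero is 0: a constant has no
    periodic primitive, so it is carried separately as \<open>b 0 * of_real y\<close>.\<close>
  define c where "c = (\<lambda>n. b n / (\<i> * n))"
  have c: "summable (\<lambda>n. norm (c n))"
    using summable_div_of_square_summable[OF b] by (simp add: c_def norm_divide norm_mult)
  define \<Phi> where "\<Phi> = (\<lambda>t::real. \<Sum>n. c n * cis (n * t))"
  have c_sum: "summable (\<lambda>n. c n * cis (n * t))" for t :: real
    by (rule summable_norm_cancel) (use c in \<open>simp add: norm_mult\<close>)
  \<comment> \<open>The integral of \<open>S (N j)\<close> over [0, y] is a partial sum of the
    series for \<open>\<Phi> y - \<Phi> 0\<close> plus \<open>b 0 * of_real y\<close>. Dominated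
    convergence on one side and summation on the other give the identity.\<close>
  have \<Phi>_eq: "\<Phi> y = \<Phi> 0 + ((LINT t:{0..y}|lborel. u t) - b 0 * of_real y)" if y: "0 < y" "y < 2*pi" for y
  proof -
    have set_int: "(LINT t:{0..y}|lborel. f t) = integral\<^sup>L (seg 0) (\<lambda>t. indicator {0..y} t *\<^sub>R f t)" for f :: "real \<Rightarrow> complex"
      using set_integral_subseg[of y 0 f] y by simp
    have "(\<lambda>j. integral\<^sup>L (seg 0) (\<lambda>t. indicator {0..y} t *\<^sub>R S (N j) t)) \<longlonglongrightarrow>
        integral\<^sup>L (seg 0) (\<lambda>t. indicator {0..y} t *\<^sub>R u t)"
    proof (rule integral_dominated_convergence)
      have ind: "indicator {0..y} \<in> borel_measurable (seg 0)" by (intro seg_measurable) auto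
      show "(\<lambda>t. indicator {0..y} t *\<^sub>R u t) \<in> borel_measurable (seg 0)"
        "(\<lambda>t. indicator {0..y} t *\<^sub>R S (N j) t) \<in> borel_measurable (seg 0)" for j
        using u S_meas ind by (intro borel_measurable_scaleR; simp)+
      show "integrable (seg 0) (\<lambda>t. 1 + W t)"
        using W by simp
      show "AE t in seg 0. (\<lambda>j. indicator {0..y} t *\<^sub>R S (N j) t) \<longlonglongrightarrow> indicator {0..y} t *\<^sub>R u t"
        using lim by eventually_elim (intro tendsto_intros)
      show "AE t in seg 0. norm (indicator {0..y} t *\<^sub>R S (N j) t) \<le> 1 + W t" for j
        using bound
      proof eventually_elim
        case (elim t)
        have "cmod (S (N j) t) \<le> 1 + (cmod (S (N j) t))\<^sup>2"
          using sum_squares_bound[of 1 "cmod (S (N j) t)"] norm_ge_zero[of "S (N j) t"] by (simp only: power_one)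
        moreover have "0 \<le> W t" using elim order_trans[OF zero_le_power2] by blast
        ultimately show ?case using elim[rule_format, of j] by (auto simp: indicator_def)
      qed
    qed
    then have L1: "(\<lambda>j. (LINT t:{0..y}|lborel. S (N j) t)) \<longlonglongrightarrow> (LINT t:{0..y}|lborel. u t)"
      unfolding set_int .
    define x where "x = (\<lambda>n. if n = 0 then b 0 * of_real y else c n * cis (n * y) - c n)"
    have "(\<lambda>n. (if n = 0 then b 0 * of_real y else 0) + (c n * cis (n * y) - c n * cis (real n * 0))) sums
        (b 0 * of_real y + (\<Phi> y - \<Phi> 0))"
      unfolding \<Phi>_def by (intro sums_add sums_diff summable_sums c_sum sums_single[of 0 "\<lambda>_. b 0 * of_real y"])
    moreover have "(if n = 0 then b 0 * of_real y else 0) + (c n * cis (n * y) - c n * cis (real n * 0)) = x n" for n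
      by (simp add: x_def c_def)
    ultimately have "x sums (b 0 * of_real y + (\<Phi> y - \<Phi> 0))" by simp
    then have L2: "(\<lambda>j. \<Sum>n<N j. x n) \<longlonglongrightarrow> b 0 * of_real y + (\<Phi> y - \<Phi> 0)"
      unfolding sums_def by (rule filterlim_compose[OF _ N_lim])
    have "(LINT t:{0..y}|lborel. S (N j) t) = (\<Sum>n<N j. x n)" for j
      unfolding S_def x_def c_def using y
      by (subst set_integral_cis_sum) (auto intro!: sum.cong simp: right_diff_distrib)
    with L1 L2 have "(LINT t:{0..y}|lborel. u t) = b 0 * of_real y + (\<Phi> y - \<Phi> 0)"
      using LIMSEQ_unique by simp
    then show ?thesis by simp
  qed

  have "AE x in lborel. x \<noteq> 0 \<and> x \<noteq> 2*pi"
    using AE_lborel_singleton[of 0] AE_lborel_singleton[of "2*pi"] by eventually_elim auto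
  then have "AE x in seg 0. 0 < x \<and> x < 2*pi" by (intro AE_segI) auto
  with AE_has_vector_derivative_integral[OF integrable_of_square_le[OF u W u_le]]
  have bv: "AE x in seg 0. boundary_val g x = u x"
  proof eventually_elim
    case (elim x)
    have "((\<lambda>y. b 0 * complex_of_real y) has_vector_derivative b 0 * of_real 1) (at x)"
      by (intro has_vector_derivative_mult_right has_vector_derivative_of_real DERIV_ident)
    with elim(1) have "((\<lambda>y. \<Phi> 0 + ((LINT t:{0..y}|lborel. u t) - b 0 * of_real y)) has_vector_derivative u x - b 0) (at x)"
      by (auto intro!: derivative_eq_intros)
    then have "(\<Phi> has_vector_derivative u x - b 0) (at x)"
      by (rule has_vector_derivative_transform_within_open[where S = "{0<..<2*pi}"]) (use elim(2) \<Phi>_eq in auto)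
    from abel_sum_at_differentiability_point[OF c this[unfolded \<Phi>_def]]
    have "((\<lambda>r. b 0 + (\<Sum>n. \<i> * n * c n * of_real r ^ n * cis (n * x))) \<longlongrightarrow> b 0 + (u x - b 0)) (at_left 1)"
      by (intro tendsto_intros)
    \<comment> \<open>The product of \<i>, n and \<open>c n\<close> is \<open>b n\<close> for n
      \<ge> 1 and 0 for n = 0, so the Abel sum is \<open>g\<close> on the radius without its
      constant term.\<close>
    moreover have "b 0 + (\<Sum>n. \<i> * n * c n * of_real r ^ n * cis (n * x)) = g (of_real r * cis x)" if r: "0 < r" "r < 1" for r
    proof -
      have r': "0 \<le> r" using r by simp
      have s: "summable (\<lambda>n. b n * of_real r ^ n * cis (n * x))"
        by (rule summable_norm_cancel) (use taylor_series_circle(1)[OF g r' r(2)] in \<open>simp add: b_def norm_mult\<close>)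
      have "(\<lambda>n. b n * of_real r ^ n * cis (n * x) - (if n = 0 then b 0 else 0)) sums (g (of_real r * cis x) - b 0)"
        unfolding taylor_series_circle(2)[OF g r' r(2)] b_def[symmetric]
        by (intro sums_diff summable_sums s sums_single[of 0 "\<lambda>_. b 0"])
      moreover have "b n * of_real r ^ n * cis (n * x) - (if n = 0 then b 0 else 0) = \<i> * n * c n * of_real r ^ n * cis (n * x)" for n
        by (simp add: c_def)
      ultimately show ?thesis by (simp add: sums_iff)
    qed
    then have "\<forall>\<^sub>F r in at_left 1. b 0 + (\<Sum>n. \<i> * n * c n * of_real r ^ n * cis (n * x)) = g (of_real r * cis x)"
      using eventually_at_left_real[of 0 "1::real"] by (auto elim!: eventually_mono)
    ultimately have "((\<lambda>r. g (of_real r * cis x)) \<longlongrightarrow> b 0 + (u x - b 0)) (at_left 1)"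
      by (simp cong: tendsto_cong)
    moreover have "b 0 + (u x - b 0) = u x" by simp
    ultimately have "((\<lambda>r. g (of_real r * cis x)) \<longlongrightarrow> u x) (at_left 1)" by (simp only:)
    then show ?case unfolding boundary_val_def by (intro tendsto_Lim) auto
  qed
  have "integral\<^sup>L (seg 0) (\<lambda>t. (cmod (boundary_val g t))\<^sup>2) = integral\<^sup>L (seg 0) (\<lambda>t. (cmod (u t))\<^sup>2)"
  proof (rule integral_cong_AE)
    show "(\<lambda>t. (cmod (boundary_val g t))\<^sup>2) \<in> borel_measurable (seg 0)"
      using seg_measurable[OF boundary_val_measurable[OF g]] by measurable
    show "AE t in seg 0. (cmod (boundary_val g t))\<^sup>2 = (cmod (u t))\<^sup>2"
      using bv by eventually_elim simp
  qed (use u in measurable)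
  then have "(H2_norm g)\<^sup>2 = (\<Sum>n. (cmod (b n))\<^sup>2)"
    using norm_u set_integral_seg[of 0 "\<lambda>t. (cmod (boundary_val g t))\<^sup>2"] suminf_nonneg[OF b]
    by (simp add: H2_norm_def)
  then show ?thesis using b by (simp add: sums_iff b_def)
qed

section \<open>The potential of an arc\<close>

text \<open>The Herglotz integral of the indicator function of the arc: its real part is the
  harmonic measure of the arc, and the exponential of \<open>ln s\<close> times it is the outer
  function of modulus \<open>s\<close> on the arc and 1 off it.\<close>

definition arc_potential :: "real \<Rightarrow> real \<Rightarrow> complex \<Rightarrow> complex" where
  "arc_potential a lam z = (LINT t:{a..a + 2*pi*lam}|lborel. (cis t + z) / (cis t - z)) / (2*pi)"

lemma herglotz_kernel_continuous:
  assumes "norm z < 1"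
  shows "continuous_on S (\<lambda>t. (cis t + z) / (cis t - z))"
proof -
  have "cis t - z \<noteq> 0" for t using assms norm_cis[of t] by (metis eq_iff_diff_eq_0 less_irrefl)
  then show ?thesis by (auto intro!: continuous_intros)
qed

lemma arc_potential_holomorphic: "arc_potential a lam holomorphic_on ball 0 1"
proof -
  have nz: "cis t - z \<noteq> 0" if "z \<in> ball 0 1" for t z
    using that norm_cis[of t] by (metis eq_iff_diff_eq_0 less_irrefl mem_ball_0)
  have "(\<lambda>z. integral (cbox a (a + 2*pi*lam)) (\<lambda>t. (cis t + z) / (cis t - z))) holomorphic_on ball 0 1"
  proof (rule leibniz_rule_holomorphic)
    fix z t assume z: "z \<in> ball (0::complex) 1"
    show "((\<lambda>z. (cis t + z) / (cis t - z)) has_field_derivative 2 * cis t / (cis t - z)^2) (at z within ball 0 1)"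
      using nz[OF z, of t] by (auto intro!: derivative_eq_intros simp: power2_eq_square field_simps)
  next
    fix z assume z: "z \<in> ball (0::complex) 1"
    show "(\<lambda>t. (cis t + z) / (cis t - z)) integrable_on cbox a (a + 2*pi*lam)"
      by (intro integrable_continuous herglotz_kernel_continuous) (use z in simp)
  next
    show "continuous_on (ball 0 1 \<times> cbox a (a + 2*pi*lam)) (\<lambda>(z, t). 2 * cis t / (cis t - z)^2)"
      using nz by (auto intro!: continuous_intros simp: case_prod_unfold)
  qed simp
  then have "(\<lambda>z. integral (cbox a (a + 2*pi*lam)) (\<lambda>t. (cis t + z) / (cis t - z)) / (2*pi)) holomorphic_on ball 0 1"
    by (intro holomorphic_intros) auto
  moreover have "integral (cbox a (a + 2*pi*lam)) (\<lambda>t. (cis t + z) / (cis t - z)) / (2*pi) = arc_potential a lam z"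
    if "z \<in> ball 0 1" for z
    unfolding arc_potential_def cbox_interval using that
    by (subst set_borel_integral_eq_integral(2)[OF borel_integrable_atLeastAtMost'[OF herglotz_kernel_continuous]]) auto
  ultimately show ?thesis using holomorphic_transform by blast
qed

lemma poisson_kernel_minus: "poisson_kernel r (- t) = poisson_kernel r t"
  by (simp add: poisson_kernel_def poisson_den_def)

lemma Re_herglotz_kernel:
  assumes r: "0 \<le> r" "r < 1"
  shows "Re ((cis t + of_real r * cis \<theta>) / (cis t - of_real r * cis \<theta>)) = poisson_kernel r (t - \<theta>)"
proof -
  define w where "w = of_real r * cis (\<theta> - t)"
  have "cis t * w = of_real r * cis \<theta>" by (simp add: w_def cis_mult mult.left_commute)
  then have "(cis t + of_real r * cis \<theta>) / (cis t - of_real r * cis \<theta>) = (cis t * (1 + w)) / (cis t * (1 - w))"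
    by (simp add: algebra_simps)
  also have "\<dots> = (1 + w) / (1 - w)" by simp
  finally have "Re ((cis t + of_real r * cis \<theta>) / (cis t - of_real r * cis \<theta>)) = (1 - (cmod w)\<^sup>2) / (cmod (1 - w))\<^sup>2"
    unfolding cmod_power2 by (simp add: Re_divide) (simp add: power2_eq_square algebra_simps)
  also have "\<dots> = poisson_kernel r (\<theta> - t)"
    using r by (simp add: w_def norm_mult poisson_kernel_def poisson_den_eq_norm)
  finally show ?thesis using poisson_kernel_minus[of r "t - \<theta>"] by simp
qed

lemma poisson_shift_continuous:
  assumes "0 \<le> r" "r < 1"
  shows "continuous_on S (\<lambda>t. poisson_kernel r (t - \<theta>))"
  by (intro continuous_on_compose2[OF continuous_poisson(1)[OF assms]] continuous_intros) auto

lemma Re_arc_potential: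
  assumes r: "0 \<le> r" "r < 1"
  shows "Re (arc_potential a lam (of_real r * cis \<theta>)) =
    (LINT t:{a..a + 2*pi*lam}|lborel. poisson_kernel r (t - \<theta>)) / (2*pi)"
proof -
  let ?f = "\<lambda>t. (cis t + of_real r * cis \<theta>) / (cis t - of_real r * cis \<theta>)"
  have "norm (of_real r * cis \<theta>) < 1" using r by (simp add: norm_mult)
  then have "set_integrable lborel {a..a + 2*pi*lam} ?f"
    by (intro borel_integrable_atLeastAtMost' herglotz_kernel_continuous)
  then have "Re (LINT t:{a..a + 2*pi*lam}|lborel. ?f t) = (LINT t|lborel. Re (indicator {a..a + 2*pi*lam} t *\<^sub>R ?f t))"
    unfolding set_lebesgue_integral_def set_integrable_def by (rule integral_Re[symmetric])
  also have "\<dots> = (LINT t:{a..a + 2*pi*lam}|lborel. poisson_kernel r (t - \<theta>))"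
    unfolding set_lebesgue_integral_def by (simp only: scaleR_complex.sel Re_herglotz_kernel[OF r] real_scaleR_def)
  finally show ?thesis unfolding arc_potential_def
    by (metis Re_divide_of_real of_real_mult of_real_numeral)
qed

text \<open>Harnack's inequality: the kernel is smallest at the antipodal angle, where it equals (1
  - r)/(1 + r), and the arc carries the fraction \<open>lam\<close> of the circle.\<close>

lemma Re_arc_potential_lower:
  assumes r: "0 \<le> r" "r < 1" and lam: "0 < lam"
  shows "lam * ((1 - r) / (1 + r)) \<le> Re (arc_potential a lam (of_real r * cis \<theta>))"
proof -
  let ?I = "{a..a + 2*pi*lam}"
  have le: "(1 - r) / (1 + r) \<le> poisson_kernel r t" for t
  proof -
    have "poisson_den r t \<le> (1 + r)\<^sup>2"
      using mult_left_mono[of "-1" "cos t" "2 * r"] r by (simp add: poisson_den_def power2_eq_square algebra_simps)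
    then have "(1 - r\<^sup>2) / (1 + r)\<^sup>2 \<le> poisson_kernel r t"
      unfolding poisson_kernel_def using r poisson_den_pos[OF r, of t]
      by (intro divide_left_mono) (auto simp: abs_square_le_1)
    moreover have "(1 - r\<^sup>2) / (1 + r)\<^sup>2 = (1 - r) / (1 + r)"
      using r by (simp add: power2_eq_square divide_simps) (simp add: algebra_simps)
    ultimately show ?thesis by simp
  qed
  define q where "q = (1 - r) / (1 + r)"
  have "(LINT t:?I|lborel. q) \<le> (LINT t:?I|lborel. poisson_kernel r (t - \<theta>))"
    by (rule set_integral_mono)
       (auto intro!: borel_integrable_atLeastAtMost' poisson_shift_continuous r le[folded q_def])
  moreover have "(LINT t:?I|lborel. q) = 2*pi*lam * q"
    using lam by (subst set_integral_const) auto
  ultimately show ?thesis unfolding Re_arc_potential[OF r] q_def[symmetric] by (simp add: field_simps)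
qed

text \<open>Enlarging the arc to the whole circle gives total mass 1. Hence the outer function built
  from the potential has modulus at most \<open>s\<close> in the disk when s \<ge> 1.\<close>

lemma Re_arc_potential_le_1:
  assumes r: "0 \<le> r" "r < 1" and lam: "0 < lam" "lam < 1"
  shows "Re (arc_potential a lam (of_real r * cis \<theta>)) \<le> 1"
proof -
  let ?I = "{a..a + 2*pi*lam}"
  have "(LINT t:?I|lborel. poisson_kernel r (t - \<theta>)) = integral\<^sup>L (seg a) (\<lambda>t. indicator ?I t *\<^sub>R poisson_kernel r (t - \<theta>))"
    by (intro set_integral_subseg) (use lam in \<open>simp add: mult_left_le\<close>)
  also have "\<dots> \<le> integral\<^sup>L (seg a) (\<lambda>t. poisson_kernel r (t - \<theta>))"
  proof (rule integral_mono)
    show "integrable (seg a) (\<lambda>t. poisson_kernel r (t - \<theta>))"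
      by (intro integrable_seg_continuous poisson_shift_continuous r)
    then show "integrable (seg a) (\<lambda>t. indicator ?I t *\<^sub>R poisson_kernel r (t - \<theta>))"
      by (rule integrable_mult_indicator[rotated]) (auto simp: seg_def sets_restrict_space_iff less_imp_le[OF lam(2)])
    show "indicator ?I t *\<^sub>R poisson_kernel r (t - \<theta>) \<le> poisson_kernel r (t - \<theta>)" for t
      using poisson_kernel_pos[OF r, of "t - \<theta>"] by (auto simp: indicator_def)
  qed
  also have "\<dots> = 2 * pi" by (rule integral_poisson_kernel[OF r])
  finally show ?thesis unfolding Re_arc_potential[OF r] by simp
qed

text \<open>By compactness the angle \<open>\<theta>\<close> keeps a positive distance from the arc
  modulo 2 pi, which bounds the denominator of the kernel below, while its numerator 1 - r^2 tends
  to 0.\<close>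

lemma Re_arc_potential_tendsto_0:
  assumes lam: "0 < lam" and \<theta>: "a + 2*pi*lam < \<theta>" "\<theta> < a + 2*pi"
  shows "((\<lambda>r. Re (arc_potential a lam (of_real r * cis \<theta>))) \<longlongrightarrow> 0) (at_left 1)"
proof -
  let ?I = "{a..a + 2*pi*lam}"
  have "?I \<noteq> {}" using lam by simp
  then obtain s where s: "s \<in> ?I" "\<And>t. t \<in> ?I \<Longrightarrow> cos (t - \<theta>) \<le> cos (s - \<theta>)"
  proof -
    have "continuous_on ?I (\<lambda>t. cos (t - \<theta>))" by (intro continuous_intros)
    from continuous_attains_sup[OF compact_Icc \<open>?I \<noteq> {}\<close> this] show ?thesis using that by blast
  qed
  define C where "C = cos (s - \<theta>)"
  have "C < 1"
  proof -
    have "0 < (\<theta> - s) / 2" "(\<theta> - s) / 2 < pi" using s(1) \<theta> by auto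
    then have "sin ((\<theta> - s) / 2) > 0" by (rule sin_gt_zero)
    then have "cos (2 * ((\<theta> - s) / 2)) < 1" unfolding cos_double_sin by simp
    moreover have "2 * ((\<theta> - s) / 2) = - (s - \<theta>)" by simp
    ultimately show ?thesis by (simp only: cos_minus C_def)
  qed
  have upper: "Re (arc_potential a lam (of_real r * cis \<theta>)) \<le> lam * ((1 - r\<^sup>2) / (1 - C))" if r: "1/2 < r" "r < 1" for r
  proof -
    have r': "0 \<le> r" using r by simp
    have le: "poisson_kernel r (t - \<theta>) \<le> (1 - r\<^sup>2) / (1 - C)" if t: "t \<in> ?I" for t
    proof -
      have "1 - C \<le> 2 * r * (1 - C)" using r \<open>C < 1\<close> by simp
      also have "\<dots> \<le> 2 * r * (1 - cos (t - \<theta>))" using s(2)[OF t] r by (intro mult_left_mono) (auto simp: C_def)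
      also have "\<dots> \<le> 2 * r * (1 - cos (t - \<theta>)) + (1 - r)\<^sup>2" by simp
      also have "\<dots> = poisson_den r (t - \<theta>)" unfolding poisson_den_def by algebra
      finally show ?thesis unfolding poisson_kernel_def using \<open>C < 1\<close> r
        by (intro frac_le) (auto simp: abs_square_le_1)
    qed
    have "(LINT t:?I|lborel. poisson_kernel r (t - \<theta>)) \<le> (LINT t:?I|lborel. (1 - r\<^sup>2) / (1 - C))"
      by (rule set_integral_mono)
         (auto intro!: borel_integrable_atLeastAtMost' poisson_shift_continuous r' r le)
    also have "\<dots> = 2*pi*lam * ((1 - r\<^sup>2) / (1 - C))"
      using lam by (subst set_integral_const) auto
    finally show ?thesis unfolding Re_arc_potential[OF r' r(2)] by (simp add: field_simps)
  qed
  have ev: "\<forall>\<^sub>F r in at_left 1. r \<in> {1/2<..<1::real}" by (intro eventually_at_left_real) simp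
  show ?thesis
  proof (rule tendsto_sandwich)
    show "\<forall>\<^sub>F r in at_left 1. Re (arc_potential a lam (of_real r * cis \<theta>)) \<le> lam * ((1 - r\<^sup>2) / (1 - C))"
      using ev by eventually_elim (use upper in auto)
    show "\<forall>\<^sub>F r in at_left 1. 0 \<le> Re (arc_potential a lam (of_real r * cis \<theta>))"
      using ev
    proof eventually_elim
      case (elim r)
      then have "0 \<le> lam * ((1 - r) / (1 + r))" using lam
        by (intro mult_nonneg_nonneg divide_nonneg_nonneg) auto
      moreover have "lam * ((1 - r) / (1 + r)) \<le> Re (arc_potential a lam (of_real r * cis \<theta>))"
        using elim lam by (intro Re_arc_potential_lower) auto
      ultimately show ?case by linarith
    qed
    have "((\<lambda>r. lam * ((1 - r\<^sup>2) / (1 - C))) \<longlongrightarrow> lam * ((1 - 1\<^sup>2) / (1 - C))) (at_left 1)"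
      by (intro tendsto_intros) (use \<open>C < 1\<close> in simp)
    then show "((\<lambda>r. lam * ((1 - r\<^sup>2) / (1 - C))) \<longlongrightarrow> 0) (at_left 1)" by simp
  qed simp
qed

section \<open>Outer multiplication and the mean square estimate\<close>

lemma abs_summable_boundary_limit:
  fixes \<theta> :: real
  assumes f: "f holomorphic_on ball 0 1" and c: "summable (\<lambda>n. norm (taylor_coeff f n))"
  shows "((\<lambda>r. f (of_real r * cis \<theta>)) \<longlongrightarrow> (\<Sum>n. taylor_coeff f n * cis (n * \<theta>))) (at_left 1)"
proof -
  let ?F = "\<lambda>r. \<Sum>n. taylor_coeff f n * of_real r ^ n * cis (n * \<theta>)"
  \<comment> \<open>Absolute summability gives uniform convergence in \<open>r\<close> up to and
    including 1, so the limit exists at every angle.\<close>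
  have "continuous_on {0..1::real} ?F"
  proof (rule uniform_limit_theorem[OF _ Weierstrass_m_test])
    show "\<forall>\<^sub>F N in sequentially. continuous_on {0..1} (\<lambda>r::real. \<Sum>n<N. taylor_coeff f n * of_real r ^ n * cis (n * \<theta>))"
      by (intro always_eventually allI continuous_intros)
    show "norm (taylor_coeff f n * of_real r ^ n * cis (n * \<theta>)) \<le> norm (taylor_coeff f n)"
      if "r \<in> {0..1}" for n and r :: real
      using that by (simp add: norm_mult norm_power mult_left_le power_le_one)
  qed (use c in auto)
  then have "(?F \<longlongrightarrow> ?F 1) (at 1 within {0..1})" unfolding continuous_on_def by (rule bspec) simp
  moreover have "at 1 within {0..1::real} = at_left 1" by (simp add: at_within_Icc_at_left)
  ultimately have "(?F \<longlongrightarrow> (\<Sum>n. taylor_coeff f n * cis (n * \<theta>))) (at_left 1)" by simp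
  moreover have "\<forall>\<^sub>F r in at_left 1. ?F r = f (of_real r * cis \<theta>)"
    using eventually_at_left_real[of 0 "1::real", simplified]
    by eventually_elim (use taylor_series_circle(2)[OF f] in auto)
  ultimately show ?thesis by (simp cong: tendsto_cong)
qed

lemma norm_le_sum_taylor_coeff:
  assumes f: "f holomorphic_on ball 0 1" and c: "summable (\<lambda>n. norm (taylor_coeff f n))"
    and r: "0 \<le> r" "r < 1"
  shows "norm (f (of_real r * cis \<theta>)) \<le> (\<Sum>n. norm (taylor_coeff f n))"
proof -
  have "norm (f (of_real r * cis \<theta>)) \<le> (\<Sum>n. norm (taylor_coeff f n * of_real r ^ n))"
    unfolding taylor_series_circle(2)[OF f r] by (rule norm_cis_series_le[OF taylor_series_circle(1)[OF f r]])
  also have "\<dots> \<le> (\<Sum>n. norm (taylor_coeff f n))"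
    using r by (intro suminf_le taylor_series_circle(1)[OF f r] c) (auto simp: norm_mult norm_power mult_left_le power_le_one)
  finally show ?thesis .
qed

text \<open>A two-constants estimate in \<open>L\<^sup>2\<close>: multiply \<open>f\<close> by the outer function whose modulus on the
  circle is \<open>s\<close> on the arc and 1 off it, and compare the means on the circles of radius \<open>r\<close> and 1.\<close>

lemma two_constants_mean_square:
  assumes f: "f holomorphic_on ball 0 1" and c: "summable (\<lambda>n. norm (taylor_coeff f n))"
    and lam: "0 < lam" "lam < 1" and s: "1 \<le> s" and r: "0 \<le> r" "r < 1"
  shows "s powr (2 * lam * ((1 - r) / (1 + r))) * (\<Sum>n. (cmod (taylor_coeff f n))\<^sup>2 * r ^ (2 * n))
     \<le> s\<^sup>2 * lam * (arc_norm f a lam)\<^sup>2 + (\<Sum>n. (cmod (taylor_coeff f n))\<^sup>2)"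
proof -
  let ?I = "{a..a + 2*pi*lam}"
  define W where "W = arc_potential a lam"
  define h where "h = (\<lambda>z. exp (of_real (ln s) * W z))"
  define G where "G = (\<lambda>z. f z * h z)"
  define F where "F = (\<lambda>\<theta>::real. \<Sum>n. taylor_coeff f n * cis (n * \<theta>))"
  define A where "A = (\<Sum>n. norm (taylor_coeff f n))"
  define \<kappa> where "\<kappa> = s powr (2 * lam * ((1 - r) / (1 + r)))"
  have h_hol: "h holomorphic_on ball 0 1" and G_hol: "G holomorphic_on ball 0 1"
    unfolding h_def G_def W_def by (intro holomorphic_intros f arc_potential_holomorphic)+
  have norm_h: "(cmod (h z))\<^sup>2 = s powr (2 * Re (W z))" for z
    using s by (simp add: h_def powr_def power2_eq_square mult_exp_exp algebra_simps)
  have bv: "boundary_val f \<theta> = F \<theta>" for \<theta>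
    unfolding boundary_val_def F_def by (intro tendsto_Lim abs_summable_boundary_limit f c) auto
  have cont_F: "continuous_on UNIV F" unfolding F_def by (rule continuous_on_cis_series[OF c])
  have cont_circle: "continuous_on UNIV (\<lambda>t. g (of_real \<rho> * cis t))" if "g holomorphic_on ball 0 1" "0 \<le> \<rho>" "\<rho> < 1" for g :: "complex \<Rightarrow> complex" and \<rho>
    using that(2,3) by (intro continuous_on_compose2[OF holomorphic_on_imp_continuous_on[OF that(1)]] continuous_intros) (auto simp: norm_mult)
  have ind: "indicator ?I \<in> borel_measurable (seg a)" "indicator (- ?I) \<in> borel_measurable (seg a)"
    by (intro seg_measurable; simp)+

  have lower: "2 * pi * (\<kappa> * (\<Sum>n. (cmod (taylor_coeff f n))\<^sup>2 * r ^ (2 * n))) \<le>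
      integral\<^sup>L (seg a) (\<lambda>t. (cmod (G (of_real r * cis t)))\<^sup>2)"
  proof -
    have "2 * pi * (\<Sum>n. (cmod (taylor_coeff f n))\<^sup>2 * r ^ (2 * n)) =
        integral\<^sup>L (seg a) (\<lambda>t. (cmod (f (of_real r * cis t)))\<^sup>2)"
      using sums_mult[OF circle_mean_square[OF f r, of a], of "1 / (2*pi)"] by (simp add: sums_iff)
    then have "2 * pi * (\<kappa> * (\<Sum>n. (cmod (taylor_coeff f n))\<^sup>2 * r ^ (2 * n))) =
        integral\<^sup>L (seg a) (\<lambda>t. \<kappa> * (cmod (f (of_real r * cis t)))\<^sup>2)" by simp
    also have "\<dots> \<le> integral\<^sup>L (seg a) (\<lambda>t. (cmod (G (of_real r * cis t)))\<^sup>2)"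
    proof (rule integral_mono)
      show "\<kappa> * (cmod (f (of_real r * cis t)))\<^sup>2 \<le> (cmod (G (of_real r * cis t)))\<^sup>2" for t
      proof -
        have "\<kappa> \<le> (cmod (h (of_real r * cis t)))\<^sup>2"
          unfolding norm_h \<kappa>_def W_def using Re_arc_potential_lower[OF r lam(1), of a t] s
          by (intro powr_mono) auto
        from mult_right_mono[OF this, of "(cmod (f (of_real r * cis t)))\<^sup>2"] show ?thesis
          by (simp add: G_def norm_mult power_mult_distrib mult.commute)
      qed
    qed (intro integrable_seg_continuous continuous_intros cont_circle f G_hol r)+
    finally show ?thesis .
  qed

  \<comment> \<open>Radii tending to 1 and never below \<open>r\<close>, so that monotonicity of the
    circle means of \<open>G\<close> applies to each.\<close>
  define R where "R = (\<lambda>n. 1 - (1 - r) / real (n + 1))"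
  have R: "r \<le> R n" "R n < 1" "0 \<le> R n" for n
  proof -
    have "(1 - r) / real (n + 1) \<le> 1 - r" using r by (simp add: divide_le_eq mult_left_le)
    then show "r \<le> R n" "0 \<le> R n" using r by (simp_all add: R_def del: of_nat_add)
    show "R n < 1" using r by (simp add: R_def)
  qed
  have R_lim: "filterlim R (at_left 1) sequentially"
  proof (rule tendsto_imp_filterlim_at_left)
    have "(\<lambda>n. 1 - (1 - r) * (1 / real (n + 1))) \<longlonglongrightarrow> 1 - (1 - r) * 0"
      by (intro tendsto_intros LIMSEQ_ignore_initial_segment lim_1_over_n)
    then show "R \<longlonglongrightarrow> 1" by (simp add: R_def)
  qed (use R in auto)

  \<comment> \<open>On the arc |h|^2 is replaced at once by its bound s^2; off the arc it is kept,
    since there it tends to 1 and that limit is what makes the bound sharp enough.\<close>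
  define K where "K = (\<lambda>n t. (cmod (f (of_real (R n) * cis t)))\<^sup>2 *
      (indicator ?I t * s\<^sup>2 + indicator (- ?I) t * (cmod (h (of_real (R n) * cis t)))\<^sup>2))"
  define K0 where "K0 = (\<lambda>t. (cmod (F t))\<^sup>2 * (indicator ?I t * s\<^sup>2 + indicator (- ?I) t))"
  have h_le: "(cmod (h (of_real (R n) * cis t)))\<^sup>2 \<le> s\<^sup>2" for n t
  proof -
    have "s powr (2 * Re (W (of_real (R n) * cis t))) \<le> s powr 2"
      unfolding W_def using Re_arc_potential_le_1[OF R(3)[of n] R(2)[of n] lam, of a t] s by (intro powr_mono) auto
    then show ?thesis unfolding norm_h using s by simp
  qed
  have circle_meas: "(\<lambda>t. (cmod (g (of_real (R n) * cis t)))\<^sup>2) \<in> borel_measurable (seg a)"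
    if "g holomorphic_on ball 0 1" for g n
    by (intro seg_measurable borel_measurable_continuous_onI continuous_intros cont_circle that R)
  have F_meas: "(\<lambda>t. (cmod (F t))\<^sup>2) \<in> borel_measurable (seg a)"
    by (intro seg_measurable borel_measurable_continuous_onI continuous_intros cont_F)
  have K_meas: "K n \<in> borel_measurable (seg a)" "K0 \<in> borel_measurable (seg a)" for n
    unfolding K_def K0_def
    by (rule borel_measurable_times[OF circle_meas[OF f] borel_measurable_add[OF borel_measurable_times[OF ind(1) borel_measurable_const] borel_measurable_times[OF ind(2) circle_meas[OF h_hol]]]],
        rule borel_measurable_times[OF F_meas borel_measurable_add[OF borel_measurable_times[OF ind(1) borel_measurable_const] ind(2)]])
  have K_bound: "norm (K n t) \<le> A\<^sup>2 * s\<^sup>2" for n t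
  proof -
    have "norm (K n t) = K n t" unfolding K_def by (auto simp: indicator_def)
    also have "\<dots> \<le> A\<^sup>2 * s\<^sup>2" unfolding K_def A_def
      using h_le[of n t] norm_le_sum_taylor_coeff[OF f c R(3,2), of n t]
      by (intro mult_mono power_mono) (auto simp: indicator_def)
    finally show ?thesis .
  qed
  have "integral\<^sup>L (seg a) (\<lambda>t. (cmod (G (of_real r * cis t)))\<^sup>2) \<le> integral\<^sup>L (seg a) (K n)" for n
  proof -
    have "integral\<^sup>L (seg a) (\<lambda>t. (cmod (G (of_real r * cis t)))\<^sup>2) \<le>
        integral\<^sup>L (seg a) (\<lambda>t. (cmod (G (of_real (R n) * cis t)))\<^sup>2)"
      by (intro circle_mean_square_mono G_hol r R)
    also have "\<dots> \<le> integral\<^sup>L (seg a) (K n)"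
    proof (rule integral_mono)
      show "integrable (seg a) (\<lambda>t. (cmod (G (of_real (R n) * cis t)))\<^sup>2)"
        by (intro integrable_seg_continuous continuous_intros cont_circle G_hol R)
      show "integrable (seg a) (K n)" by (rule integrable_seg_bounded[OF K_meas(1) K_bound])
      show "(cmod (G (of_real (R n) * cis t)))\<^sup>2 \<le> K n t" for t
        using h_le[of n t] by (auto simp: G_def K_def norm_mult power_mult_distrib indicator_def mult_left_mono)
    qed
    finally show ?thesis .
  qed
  moreover have "(\<lambda>n. integral\<^sup>L (seg a) (K n)) \<longlonglongrightarrow> integral\<^sup>L (seg a) K0"
  proof (rule integral_dominated_convergence[OF K_meas(2,1)])
    show "integrable (seg a) (\<lambda>_. A\<^sup>2 * s\<^sup>2)" by simp
    show "AE t in seg a. norm (K n t) \<le> A\<^sup>2 * s\<^sup>2" for n using K_bound by simp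
    have lim: "(\<lambda>n. K n t) \<longlonglongrightarrow> K0 t" if t: "a \<le> t" "t < a + 2*pi" for t
    proof -
      have f_lim: "(\<lambda>n. f (of_real (R n) * cis t)) \<longlonglongrightarrow> F t"
        unfolding F_def by (rule filterlim_compose[OF abs_summable_boundary_limit[OF f c] R_lim])
      show ?thesis
      proof (cases "t \<in> ?I")
        case True
        then have "K n t = (cmod (f (of_real (R n) * cis t)))\<^sup>2 * s\<^sup>2" "K0 t = (cmod (F t))\<^sup>2 * s\<^sup>2" for n
          by (simp_all add: K_def K0_def)
        then show ?thesis using f_lim by (auto intro!: tendsto_intros)
      next
        case False
        then have "(\<lambda>n. Re (W (of_real (R n) * cis t))) \<longlonglongrightarrow> 0"
          unfolding W_def using t
          by (intro filterlim_compose[OF Re_arc_potential_tendsto_0[OF lam(1)] R_lim]) auto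
        then have "(\<lambda>n. (cmod (f (of_real (R n) * cis t)))\<^sup>2 * s powr (2 * Re (W (of_real (R n) * cis t)))) \<longlonglongrightarrow>
            (cmod (F t))\<^sup>2 * s powr (2 * 0)"
          using f_lim s by (intro tendsto_intros) auto
        then show ?thesis using False s by (simp add: K_def K0_def norm_h)
      qed
    qed
    \<comment> \<open>This parameter lies outside the interval of the arc but is the same point of
      the circle as its endpoint \<open>a\<close>, where |h| need not tend to 1.\<close>
    have "AE t in lborel. t \<noteq> a + 2*pi" by (rule AE_lborel_singleton)
    then show "AE t in seg a. (\<lambda>n. K n t) \<longlonglongrightarrow> K0 t"
      by (intro AE_segI, elim eventually_mono) (use lim in auto)
  qed
  ultimately have upper: "integral\<^sup>L (seg a) (\<lambda>t. (cmod (G (of_real r * cis t)))\<^sup>2) \<le> integral\<^sup>L (seg a) K0"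
    by (intro LIMSEQ_le_const) auto

  have int_F: "integrable (seg a) (\<lambda>t. (cmod (F t))\<^sup>2)"
    by (intro integrable_seg_continuous continuous_intros cont_F)
  have int_IF: "integrable (seg a) (\<lambda>t. indicator ?I t *\<^sub>R (cmod (F t))\<^sup>2)"
    by (rule integrable_mult_indicator[OF _ int_F]) (auto simp: seg_def sets_restrict_space_iff less_imp_le[OF lam(2)])
  have F_le: "cmod (F t) \<le> A" for t unfolding F_def A_def by (rule norm_cis_series_le[OF c])
  have "integral\<^sup>L (seg a) K0 \<le> integral\<^sup>L (seg a) (\<lambda>t. s\<^sup>2 * (indicator ?I t *\<^sub>R (cmod (F t))\<^sup>2) + (cmod (F t))\<^sup>2)"
  proof (rule integral_mono)
    show "integrable (seg a) K0"
    proof (rule integrable_seg_bounded[OF K_meas(2)])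
      show "norm (K0 t) \<le> A\<^sup>2 * s\<^sup>2" for t
      proof -
        have "norm (K0 t) = K0 t" unfolding K0_def by (auto simp: indicator_def)
        also have "\<dots> \<le> A\<^sup>2 * s\<^sup>2" unfolding K0_def
          using F_le[of t] s by (intro mult_mono power_mono) (auto simp: indicator_def)
        finally show ?thesis .
      qed
    qed
    show "K0 t \<le> s\<^sup>2 * (indicator ?I t *\<^sub>R (cmod (F t))\<^sup>2) + (cmod (F t))\<^sup>2" for t
      by (auto simp: K0_def indicator_def)
  qed (use int_F int_IF in auto)
  also have "\<dots> = s\<^sup>2 * integral\<^sup>L (seg a) (\<lambda>t. indicator ?I t *\<^sub>R (cmod (F t))\<^sup>2) + integral\<^sup>L (seg a) (\<lambda>t. (cmod (F t))\<^sup>2)"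
    using int_F int_IF by simp
  also have "integral\<^sup>L (seg a) (\<lambda>t. indicator ?I t *\<^sub>R (cmod (F t))\<^sup>2) = 2*pi*lam * (arc_norm f a lam)\<^sup>2"
  proof -
    have "integral\<^sup>L (seg a) (\<lambda>t. indicator ?I t *\<^sub>R (cmod (F t))\<^sup>2) = (LINT t:?I|lborel. (cmod (boundary_val f t))\<^sup>2)"
      unfolding bv by (intro set_integral_subseg[symmetric]) (use lam in \<open>simp add: mult_left_le\<close>)
    moreover have "0 \<le> integral\<^sup>L (seg a) (\<lambda>t. indicator ?I t *\<^sub>R (cmod (F t))\<^sup>2)"
      by (intro integral_nonneg_AE) auto
    ultimately show ?thesis using lam by (simp add: arc_norm_def)
  qed
  also have "integral\<^sup>L (seg a) (\<lambda>t. (cmod (F t))\<^sup>2) = 2 * pi * (\<Sum>n. (cmod (taylor_coeff f n))\<^sup>2)"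
    using sums_mult[OF integral_seg_parseval_norm[OF c, of a], of "1 / (2*pi)"] unfolding F_def by (simp add: sums_iff)
  finally have "2 * pi * (\<kappa> * (\<Sum>n. (cmod (taylor_coeff f n))\<^sup>2 * r ^ (2 * n))) \<le>
      2 * pi * (s\<^sup>2 * lam * (arc_norm f a lam)\<^sup>2 + (\<Sum>n. (cmod (taylor_coeff f n))\<^sup>2))"
    using lower upper by (simp add: algebra_simps)
  then show ?thesis unfolding \<kappa>_def by simp
qed

section \<open>Coefficient estimates\<close>

lemma taylor_coeff_funpow_deriv:
  "taylor_coeff ((deriv ^^ k) f) n = (fact (n + k) / fact n) * taylor_coeff f (n + k)"
  by (simp add: taylor_coeff_def funpow_add)

text \<open>One derivative suffices: the coefficient of index n + 1 is that of
  \<open>deriv f\<close> divided by n + 1, and square summable sequences become summable after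
  division by n.\<close>

lemma HS_abs_summable:
  assumes "f \<in> HS k" "k \<ge> 1"
  shows "summable (\<lambda>n. norm (taylor_coeff f n))"
proof -
  have "deriv f \<in> H2" using assms unfolding HS_def by force
  from summable_div_of_square_summable[OF H2_coeff_square_summable[OF this]]
  have "summable (\<lambda>n. cmod (taylor_coeff (deriv f) n) / n)" .
  moreover have "norm (norm (taylor_coeff f (Suc n))) \<le> cmod (taylor_coeff (deriv f) n) / n" if "n \<ge> 1" for n
  proof -
    have "taylor_coeff (deriv f) n = of_nat (n + 1) * taylor_coeff f (Suc n)"
      using taylor_coeff_funpow_deriv[of 1 f n] by simp
    then have "cmod (taylor_coeff (deriv f) n) = real (n + 1) * cmod (taylor_coeff f (Suc n))"
      by (simp only: norm_mult norm_of_nat)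
    then have "cmod (taylor_coeff f (Suc n)) * real n \<le> cmod (taylor_coeff (deriv f) n)"
      by (simp add: mult.commute mult_right_mono)
    then show ?thesis using that by (simp add: pos_le_divide_eq)
  qed
  ultimately have "summable (\<lambda>n. norm (taylor_coeff f (Suc n)))"
    by (rule summable_comparison_test')
  then show ?thesis by (simp only: summable_Suc_iff[of "\<lambda>n. norm (taylor_coeff f n)"])
qed

text \<open>The quotient is a product of k factors n + k - j with j < k, each at least (n + k)/k;
  the induction strips them off one at a time.\<close>

lemma fact_quotient_ge:
  assumes "k \<ge> 1"
  shows "(real (n + k) / k) ^ k \<le> fact (n + k) / fact n"
proof -
  have "j \<le> k \<Longrightarrow> (real (n + k) / k) ^ j \<le> fact (n + k) / fact (n + k - j)" for j
  proof (induction j)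
    case (Suc j)
    have "real (n + k) / k \<le> real (n + k - j)"
    proof -
      have "1 * (real n + real k) + real j * k \<le> k * (real n + real k)"
      proof -
        have "real n * 1 \<le> real n * k" "real k * real (1 + j) \<le> real k * k"
          using Suc.prems assms by (intro mult_left_mono; simp)+
        then show ?thesis by (simp add: algebra_simps)
      qed
      moreover have "real (n + k - j) = real n + real k - real j" using Suc.prems by (simp add: of_nat_diff)
      ultimately show ?thesis using assms by (subst pos_divide_le_eq) (simp_all add: algebra_simps)
    qed
    then have "(real (n + k) / k) ^ Suc j \<le> real (n + k - j) * (fact (n + k) / fact (n + k - j))"
      unfolding power_Suc using Suc by (intro mult_mono) auto
    also have "\<dots> = fact (n + k) / fact (n + k - Suc j)"
    proof -
      have "n + k - j = Suc (n + k - Suc j)" using Suc.prems by simp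
      then have "(fact (n + k - j) :: real) = real (n + k - j) * fact (n + k - Suc j)" by (simp only: fact_Suc of_nat_mult)
      moreover have "real (n + k - j) \<noteq> 0" using Suc.prems by simp
      ultimately show ?thesis by (simp del: of_nat_diff)
    qed
    finally show ?case .
  qed simp
  from this[of k] show ?thesis by simp
qed

text \<open>Frequencies below \<open>1/\<delta>\<close> are controlled by the mean on the circle of radius \<open>exp (- \<delta>)\<close>,
  the others by the Sobolev norm.\<close>

lemma frequency_splitting:
  fixes x :: "nat \<Rightarrow> real"
  assumes x0: "\<And>n. 0 \<le> x n" and x: "summable x"
    and sob: "summable (\<lambda>n. (fact (n + k) / fact n)\<^sup>2 * x (n + k))" "(\<Sum>n. (fact (n + k) / fact n)\<^sup>2 * x (n + k)) \<le> 1"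
    and k: "k \<ge> 1" and \<delta>: "0 < \<delta>" "\<delta> * k \<le> 1"
  shows "suminf x \<le> exp 2 * (\<Sum>n. x n * exp (- \<delta>) ^ (2 * n)) + (k * \<delta>) ^ (2 * k)"
proof -
  \<comment> \<open>The Sobolev sum indexed by the true frequency. The weight is the square of a
    falling factorial, set to 0 below \<open>k\<close>, where the k-th derivative sees
    nothing.\<close>
  define y where "y = (\<lambda>n. if n < k then 0 else (fact n / fact (n - k))\<^sup>2 * x n)"
  have y0: "0 \<le> y n" for n using x0 by (simp add: y_def)
  have ysum: "y sums (\<Sum>n. (fact (n + k) / fact n)\<^sup>2 * x (n + k))"
  proof -
    have "(\<lambda>n. y (n + k)) sums (\<Sum>n. (fact (n + k) / fact n)\<^sup>2 * x (n + k))"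
      using summable_sums[OF sob(1)] by (simp add: y_def)
    then have "y sums ((\<Sum>n. (fact (n + k) / fact n)\<^sup>2 * x (n + k)) + sum y {..<k})"
      by (simp only: sums_iff_shift)
    then show ?thesis by (simp add: y_def)
  qed
  have e1: "exp (- \<delta>) \<le> 1" using \<delta> by simp
  have s1: "summable (\<lambda>n. x n * exp (- \<delta>) ^ (2 * n))"
  proof (rule summable_comparison_test'[OF x])
    show "norm (x n * exp (- \<delta>) ^ (2 * n)) \<le> x n" for n
      using x0[of n] e1 by (simp add: abs_mult mult_left_le power_le_one)
  qed
  have "x n \<le> exp 2 * (x n * exp (- \<delta>) ^ (2 * n)) + (k * \<delta>) ^ (2 * k) * y n" for n
  proof (cases "real n * \<delta> \<le> 1")
    case True
    have "exp (- \<delta>) ^ (2 * n) = exp (- (2 * (n * \<delta>)))"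
      by (simp add: exp_of_nat_mult[symmetric] mult_ac)
    then have "1 \<le> exp 2 * exp (- \<delta>) ^ (2 * n)" using True by (simp add: mult_exp_exp)
    from mult_left_mono[OF this x0[of n]] have "x n \<le> exp 2 * (x n * exp (- \<delta>) ^ (2 * n))"
      by (simp add: mult_ac)
    moreover have "0 \<le> (k * \<delta>) ^ (2 * k) * y n" using y0 \<delta> by simp
    ultimately show ?thesis by linarith
  next
    case False
    \<comment> \<open>The condition \<delta> k \<le> 1 enters here: a frequency above 1/\<delta>
      exceeds k, so its weight in \<open>y\<close> is the falling factorial.\<close>
    have kn: "k < n"
    proof (rule ccontr)
      assume "\<not> k < n"
      then have "\<delta> * real n \<le> \<delta> * real k" using \<delta> by (intro mult_left_mono) auto
      also note \<delta>(2)
      finally show False using False by (simp add: mult.commute)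
    qed
    \<comment> \<open>Splitting n \<delta> in this way leaves the power of n/k that the falling
      factorial dominates; the k in the constant is the price.\<close>
    have "1 \<le> (k * \<delta>) * (real n / k)" using False k by (simp add: mult.commute)
    then have "1 \<le> ((k * \<delta>) * (real n / k)) ^ k" by (rule one_le_power)
    also have "\<dots> = (k * \<delta>) ^ k * (real n / k) ^ k" by (rule power_mult_distrib)
    also have "\<dots> \<le> (k * \<delta>) ^ k * (fact n / fact (n - k))"
      using fact_quotient_ge[OF k, of "n - k"] kn \<delta> by (intro mult_left_mono) auto
    finally have "1 \<le> ((k * \<delta>) ^ k * (fact n / fact (n - k)))\<^sup>2" by (rule one_le_power)
    from mult_right_mono[OF this x0[of n]] have "x n \<le> ((k * \<delta>) ^ k * (fact n / fact (n - k)))\<^sup>2 * x n"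
      by simp
    also have "\<dots> = ((k * \<delta>) ^ k)\<^sup>2 * y n"
      using kn by (simp only: y_def power_mult_distrib[of "(k * \<delta>) ^ k"]) simp
    also have "((k * \<delta>) ^ k)\<^sup>2 = (k * \<delta>) ^ (2 * k)"
      by (simp only: power_mult[symmetric] mult.commute[of k 2])
    finally have "x n \<le> (k * \<delta>) ^ (2 * k) * y n" .
    moreover have "0 \<le> exp 2 * (x n * exp (- \<delta>) ^ (2 * n))" using x0 by simp
    ultimately show ?thesis by linarith
  qed
  then have "suminf x \<le> (\<Sum>n. exp 2 * (x n * exp (- \<delta>) ^ (2 * n)) + (k * \<delta>) ^ (2 * k) * y n)"
    using ysum s1 by (intro suminf_le x summable_add summable_mult) (auto simp: sums_iff)
  also have "\<dots> = exp 2 * (\<Sum>n. x n * exp (- \<delta>) ^ (2 * n)) + (k * \<delta>) ^ (2 * k) * suminf y"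
    using ysum s1 by (simp add: suminf_add[symmetric] suminf_mult summable_mult sums_iff)
  also have "(k * \<delta>) ^ (2 * k) * suminf y \<le> (k * \<delta>) ^ (2 * k) * 1"
    using ysum sob(2) \<delta> by (intro mult_left_mono) (auto simp: sums_iff)
  finally show ?thesis by simp
qed

text \<open>Only the top order term of the norm is kept. Passing from its boundary integral to
  coefficients is where Fatou's theorem is spent.\<close>

lemma HS_sobolev_bound:
  assumes "f \<in> HS k" "k \<ge> 1" "HS_norm k f \<le> 1"
  shows "summable (\<lambda>n. (fact (n + k) / fact n)\<^sup>2 * (cmod (taylor_coeff f (n + k)))\<^sup>2)"
    and "(\<Sum>n. (fact (n + k) / fact n)\<^sup>2 * (cmod (taylor_coeff f (n + k)))\<^sup>2) \<le> 1"
proof -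
  have "(deriv ^^ k) f \<in> H2" using assms unfolding HS_def by auto
  from H2_norm_sums[OF this]
  have s: "(\<lambda>n. (fact (n + k) / fact n)\<^sup>2 * (cmod (taylor_coeff f (n + k)))\<^sup>2) sums (H2_norm ((deriv ^^ k) f))\<^sup>2"
    unfolding taylor_coeff_funpow_deriv by (simp add: norm_mult norm_divide power_mult_distrib power_divide)
  have "(H2_norm ((deriv ^^ k) f))\<^sup>2 \<le> (\<Sum>j=0..k. (H2_norm ((deriv ^^ j) f))\<^sup>2)"
    by (rule member_le_sum[of k "{0..k}" "\<lambda>j. (H2_norm ((deriv ^^ j) f))\<^sup>2"]) auto
  also have "\<dots> \<le> 1" using assms(3) unfolding HS_norm_def by simp
  finally show "summable (\<lambda>n. (fact (n + k) / fact n)\<^sup>2 * (cmod (taylor_coeff f (n + k)))\<^sup>2)"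
    "(\<Sum>n. (fact (n + k) / fact n)\<^sup>2 * (cmod (taylor_coeff f (n + k)))\<^sup>2) \<le> 1"
    using s by (simp_all add: sums_iff)
qed

section \<open>Choice of the radius and the final estimate\<close>

lemma power_le_fact_exp:
  fixes x :: real
  assumes "0 \<le> x"
  shows "x ^ k \<le> fact k * exp x"
proof -
  have "(\<Sum>n\<in>{k}. x ^ n /\<^sub>R fact n) \<le> (\<Sum>n. x ^ n /\<^sub>R fact n)"
    using assms by (intro sum_le_suminf summable_exp_generic) auto
  then show ?thesis by (simp add: exp_def field_simps)
qed

text \<open>Stated for any positive upper bound \<epsilon> of the arc norm, so that a vanishing arc
  norm can be reached by letting \<epsilon> tend to 0.\<close>

lemma H2_norm_bound_of_arc_norm_le:
  assumes k: "k \<ge> 1" and lam: "0 < lam" "lam < 1" and f: "f \<in> HS k" "HS_norm k f \<le> 1"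
    and \<epsilon>: "arc_norm f a lam \<le> \<epsilon>" "0 < \<epsilon>" "\<epsilon> \<le> exp (- (16 * real k) / lam)"
  shows "H2_norm f \<le> (sqrt 2 * (16 * real k) ^ k + 2 ^ k * fact k) / (lam * ln (1 / \<epsilon>)) ^ k"
proof -
  define L where "L = ln (1 / \<epsilon>)"
  define m where "m = H2_norm f"
  define x where "x = (\<lambda>n. (cmod (taylor_coeff f n))\<^sup>2)"
  have fH2: "f \<in> H2" using f(1) by (simp add: HS_def)
  then have hol: "f holomorphic_on ball 0 1" by (simp add: H2_def)
  have x: "x sums m\<^sup>2" unfolding x_def m_def by (rule H2_norm_sums[OF fH2])
  have arc0: "arc_norm f a lam \<ge> 0" unfolding arc_norm_def using lam
    by (auto intro!: divide_nonneg_nonneg integral_nonneg_AE simp: set_lebesgue_integral_def)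
  have L_ge: "16 * real k \<le> lam * L"
  proof -
    have "ln \<epsilon> \<le> - (16 * real k) / lam" using \<epsilon> ln_le_cancel_iff[of \<epsilon> "exp (- (16 * real k) / lam)"] by simp
    then show ?thesis using \<epsilon> lam by (simp add: L_def ln_div field_simps)
  qed
  moreover have "0 < 16 * real k" using k by simp
  ultimately have lamL: "0 < lam * L" by linarith
  then have L0: "0 < L" using lam by (simp add: zero_less_mult_iff)
  have \<epsilon>_eq: "\<epsilon> = exp (- L)" using \<epsilon> by (simp add: L_def ln_div)
  define \<delta> where "\<delta> = 16 / (lam * L)"
  have \<delta>0: "0 < \<delta>" using lamL by (simp add: \<delta>_def)
  have \<delta>k: "\<delta> * k \<le> 1" using L_ge lamL by (simp add: \<delta>_def)
  have "\<delta> \<le> 1"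
  proof -
    have "\<delta> * 1 \<le> \<delta> * k" using k \<delta>0 by (intro mult_left_mono) auto
    then show ?thesis using \<delta>k by simp
  qed
  \<comment> \<open>Since \<epsilon> = exp (-L), the second alternative is m \<le> sqrt \<epsilon>;
    its failure makes s at least exp (L/2). The factor sqrt 2 in the first leaves the high
    frequencies less than half of m^2 when it fails.\<close>
  have "m \<le> sqrt 2 * (k * \<delta>) ^ k \<or> m \<le> exp (- (L / 2))"
  proof (cases "m \<le> \<epsilon>")
    case True
    moreover have "\<epsilon> \<le> exp (- (L / 2))" using L0 unfolding \<epsilon>_eq by simp
    ultimately show ?thesis by linarith
  next
    case m\<epsilon>: False
    define s where "s = m / \<epsilon>"
    define r where "r = exp (- \<delta>)"
    have s1: "1 \<le> s" using m\<epsilon> \<epsilon> by (simp add: s_def)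
    have r: "0 \<le> r" "r < 1" using \<delta>0 by (auto simp: r_def)
    \<comment> \<open>From exp (-\<delta>) \<le> 1/(1 + \<delta>) \<le> 1 - \<delta>/2, valid for
      \<delta> \<le> 1, together with 1 + r \<le> 2.\<close>
    have "\<delta> / 4 \<le> (1 - r) / (1 + r)"
    proof -
      have "1 + \<delta> \<le> exp \<delta>" by (rule exp_ge_add_one_self)
      then have "r \<le> 1 / (1 + \<delta>)" using \<delta>0 unfolding r_def exp_minus by (simp add: field_simps)
      also have "\<dots> \<le> 1 - \<delta> / 2"
      proof -
        have "\<delta> * \<delta> \<le> \<delta> * 1" using \<open>\<delta> \<le> 1\<close> \<delta>0 by (intro mult_left_mono) auto
        then show ?thesis using \<delta>0 by (subst pos_divide_le_eq) (simp_all add: algebra_simps)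
      qed
      finally have "\<delta> / 2 \<le> 1 - r" by simp
      then have "\<delta> / 4 * (1 + r) \<le> \<delta> / 4 * 2" "\<delta> / 4 * 2 \<le> 1 - r"
        using \<delta>0 r \<open>\<delta> / 2 \<le> 1 - r\<close> by auto
      then show ?thesis using r by (simp add: le_divide_eq)
    qed
    then have "2 * lam * (\<delta> / 4) \<le> 2 * lam * ((1 - r) / (1 + r))"
      using lam by (intro mult_left_mono) auto
    moreover have "2 * lam * (\<delta> / 4) = lam * \<delta> / 2" by simp
    ultimately have "lam * \<delta> / 2 \<le> 2 * lam * ((1 - r) / (1 + r))" by (simp only:)
    then have "s powr (lam * \<delta> / 2) \<le> s powr (2 * lam * ((1 - r) / (1 + r)))"
      using s1 by (intro powr_mono)
    moreover define P where "P = (\<Sum>n. x n * r ^ (2 * n))"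
    have P0: "0 \<le> P"
    proof -
      have "summable (\<lambda>n. x n * r ^ (2 * n))"
        using r x by (intro summable_comparison_test'[OF sums_summable[OF x]])
          (auto simp: x_def abs_mult mult_left_le power_le_one)
      then show ?thesis unfolding P_def using r by (intro suminf_nonneg) (auto simp: x_def)
    qed
    ultimately have "s powr (lam * \<delta> / 2) * P \<le> s powr (2 * lam * ((1 - r) / (1 + r))) * P"
      by (intro mult_right_mono)
    also have "\<dots> \<le> s\<^sup>2 * lam * (arc_norm f a lam)\<^sup>2 + suminf x"
      unfolding P_def x_def by (rule two_constants_mean_square[OF hol HS_abs_summable[OF f(1) k] lam s1 r])
    also have "suminf x = m\<^sup>2" using x by (simp add: sums_iff)
    \<comment> \<open>The choice s = m/\<epsilon> balances the two terms: the arc contributes at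
      most m^2, which is also the bound for the rest of the circle.\<close>
    also have "s\<^sup>2 * lam * (arc_norm f a lam)\<^sup>2 \<le> s\<^sup>2 * 1 * \<epsilon>\<^sup>2"
      using \<epsilon> arc0 lam s1 by (intro mult_mono power_mono) auto
    also have "s\<^sup>2 * 1 * \<epsilon>\<^sup>2 = m\<^sup>2" using \<epsilon> by (simp add: s_def power_divide)
    finally have sP: "s powr (lam * \<delta> / 2) * P \<le> 2 * m\<^sup>2" by simp
    have split: "m\<^sup>2 \<le> exp 2 * P + (k * \<delta>) ^ (2 * k)"
      using frequency_splitting[of x, OF _ _ _ _ k \<delta>0 \<delta>k] HS_sobolev_bound[OF f(1) k f(2)] x
      unfolding P_def r_def x_def by (simp add: sums_iff)
    show ?thesis
    proof (rule ccontr)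
      assume "\<not> ?thesis"
      then have big: "sqrt 2 * (k * \<delta>) ^ k < m" "exp (- (L / 2)) < m" by auto
      have "(sqrt 2 * (k * \<delta>) ^ k)\<^sup>2 < m\<^sup>2" using big(1) \<delta>0 by (intro power_strict_mono) auto
      then have "2 * (k * \<delta>) ^ (2 * k) < m\<^sup>2" by (simp add: power_mult_distrib power_mult[symmetric] mult.commute)
      then have "m\<^sup>2 < 2 * exp 2 * P" using split by simp
      \<comment> \<open>The contradiction aimed at is exp 4 * P \<le> 2 m^2 < 4 * exp 2 * P,
        impossible because exp 2 \<ge> 4.\<close>
      moreover have "exp 4 * P \<le> s powr (lam * \<delta> / 2) * P"
      proof (intro mult_right_mono P0)
        have "exp (L / 2) = exp (- (L / 2)) / \<epsilon>" unfolding \<epsilon>_eq by (simp add: exp_diff[symmetric])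
        also have "\<dots> \<le> s" unfolding s_def using big(2) \<epsilon> by (intro divide_right_mono) auto
        finally have "exp (L / 2) powr (lam * \<delta> / 2) \<le> s powr (lam * \<delta> / 2)"
          using lam \<delta>0 by (intro powr_mono2) auto
        moreover have "exp (L / 2) powr (lam * \<delta> / 2) = exp 4"
        proof -
          have "lam * \<delta> / 2 * (L / 2) = 4" using lamL lam L0 by (simp add: \<delta>_def)
          then show ?thesis by (simp add: powr_def)
        qed
        ultimately show "exp 4 \<le> s powr (lam * \<delta> / 2)" by simp
      qed
      ultimately have "exp 4 * P < 4 * exp 2 * P" using sP by simp
      then have "exp 2 * exp 2 * P < 4 * exp 2 * P" by (simp add: mult_exp_exp)
      moreover have "4 * exp 2 * P \<le> exp 2 * exp 2 * P"
      proof (intro mult_right_mono P0)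
        have "2 \<le> exp (1::real)" using exp_ge_add_one_self[of 1] by simp
        then have "2 * 2 \<le> exp 1 * exp (1::real)" by (intro mult_mono) auto
        then show "4 \<le> exp (2::real)" by (simp add: mult_exp_exp)
      qed auto
      ultimately show False by simp
    qed
  qed
  moreover have "sqrt 2 * (k * \<delta>) ^ k = sqrt 2 * (16 * real k) ^ k / (lam * L) ^ k"
    by (simp add: \<delta>_def power_divide mult.commute)
  \<comment> \<open>The inequality y^k \<le> k! exp y at y = L/2 turns exponential decay into the
    required power and produces the second summand of the constant.\<close>
  moreover have "exp (- (L / 2)) \<le> 2 ^ k * fact k / (lam * L) ^ k"
  proof -
    have "(lam * L / 2) ^ k \<le> (L / 2) ^ k"
      using lam L0 by (intro power_mono) (auto simp: mult_right_le_one_le mult.commute mult_left_le)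
    also have "\<dots> \<le> fact k * exp (L / 2)" using L0 by (intro power_le_fact_exp) simp
    finally have "(lam * L) ^ k \<le> 2 ^ k * fact k * exp (L / 2)" by (simp add: power_divide field_simps)
    then have "(lam * L) ^ k * exp (- (L / 2)) \<le> 2 ^ k * fact k * exp (L / 2) * exp (- (L / 2))"
      by (rule mult_right_mono) simp
    also have "\<dots> = 2 ^ k * fact k" by (simp add: mult.assoc mult_exp_exp)
    finally show ?thesis using lamL by (simp add: le_divide_eq mult.commute)
  qed
  moreover have "0 \<le> sqrt 2 * (16 * real k) ^ k / (lam * L) ^ k" "0 \<le> 2 ^ k * fact k / (lam * L) ^ k"
    using lamL by auto
  ultimately have "m \<le> sqrt 2 * (16 * real k) ^ k / (lam * L) ^ k + 2 ^ k * fact k / (lam * L) ^ k"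
    by linarith
  then show ?thesis unfolding m_def L_def by (simp add: add_divide_distrib)
qed

theorem theorem1:
  fixes k :: nat
  assumes "k \<ge> 1"
  shows "\<exists>\<alpha>::real. \<exists>\<gamma>::real. \<alpha> > 0 \<and> \<gamma> > 0 \<and>
    (\<forall>lam a f. 0 < lam \<and> lam < 1 \<and> f \<in> HS k \<and> HS_norm k f \<le> 1 \<and>
       arc_norm f a lam \<le> exp (- \<gamma> / lam) \<longrightarrow>
       H2_norm f \<le> \<alpha> / (lam * ln (1 / arc_norm f a lam)) ^ k)"
proof -
  define \<alpha> :: real where "\<alpha> = sqrt 2 * (16 * real k) ^ k + 2 ^ k * fact k"
  have "H2_norm f \<le> \<alpha> / (lam * ln (1 / arc_norm f a lam)) ^ k"
    if lam: "0 < lam" "lam < 1" and f: "f \<in> HS k" "HS_norm k f \<le> 1"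
      and arc: "arc_norm f a lam \<le> exp (- (16 * real k) / lam)" for lam a f
  proof (cases "arc_norm f a lam = 0")
    case True
    \<comment> \<open>In this case \<open>ln (1 / 0)\<close> is 0, so the right-hand side of the
      claim is 0 and the claim is a uniqueness statement: a function of zero norm on the arc has
      zero norm. Every \<epsilon> = exp (-L) with L large is an admissible bound for the arc norm,
      and L is sent to infinity.\<close>
    have bound: "H2_norm f \<le> \<alpha> / (lam * L) ^ k" if "L \<ge> 16 * real k / lam" for L
      using H2_norm_bound_of_arc_norm_le[OF assms lam f, of a "exp (- L)"] that True
      by (simp add: \<alpha>_def ln_div)
    have "((\<lambda>L. \<alpha> / (lam * L) ^ k) \<longlongrightarrow> 0) at_top"
      using assms lam by (intro real_tendsto_divide_at_top[OF tendsto_const] filterlim_pow_at_top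
          filterlim_tendsto_pos_mult_at_top[OF tendsto_const] filterlim_ident) auto
    then have "H2_norm f \<le> 0"
      by (rule tendsto_lowerbound) (use bound in \<open>auto intro: eventually_at_top_linorderI\<close>)
    then show ?thesis using True assms by (simp add: power_0_left)
  next
    case False
    have "arc_norm f a lam \<ge> 0" unfolding arc_norm_def using lam
      by (auto intro!: divide_nonneg_nonneg integral_nonneg_AE simp: set_lebesgue_integral_def)
    then show ?thesis
      using H2_norm_bound_of_arc_norm_le[OF assms lam f order_refl] False arc by (simp add: \<alpha>_def)
  qed
  moreover have "\<alpha> > 0" unfolding \<alpha>_def by (intro add_nonneg_pos) auto
  moreover have "16 * real k > 0" using assms by simp
  ultimately show ?thesis by (intro exI[of _ \<alpha>] exI[of _ "16 * real k"]) auto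
qed

end
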